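(* Let $p\ge 1$ and $n_1,\ldots,n_p$ be positive integers, $N=n_1\cdots n_p$, and $k$ a positive integer. Then: (a) $\Sigma^k(n_1,\ldots,n_p)$ is a connected, compact subset of $\Sigma(n_1,\ldots,n_p)$. In particular, if $\Sigma^k(n_1,\ldots,n_p)\neq\Sigma(n_1,\ldots,n_p)$, then it is not dense in $\Sigma(n_1,\ldots,n_p)$ and its complement in $\Sigma(n_1,\ldots,n_p)$ is (relatively) open. (b) If $k<\dfrac{n_1^2\cdots n_p^2}{1-p+\sum_{j=1}^p n_j^2}$, then $\Sigma^k(n_1,\ldots,n_p)$ has measure $0$ in $\Sigma(n_1,\ldots,n_p)$. (c) If $n_1\le n_2\le\cdots\le n_p$ and $k\ge n_1^2\cdots n_{p-1}^2$, then $\Sigma^k(n_1,\ldots,n_p)$ has positive measure in $\Sigma(n_1,\ldots,n_p)$, and in fact contains a nonempty open subset.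
   Context: For a positive integer $w$, a density matrix on $\mathbb{C}^w$ is a $w\times w$ complex Hermitian positive semi-definite matrix of trace $1$; let $\mathcal{DM}(w)$ denote the set of these. Let $N=n_1\cdots n_p$ and identify $\mathbb{C}^N=\mathbb{C}^{n_1}\otimes\cdots\otimes\mathbb{C}^{n_p}$. A product density matrix is one of the form $A_1\otimes\cdots\otimes A_p$ with $A_i\in\mathcal{DM}(n_i)$. $\Sigma(n_1,\ldots,n_p)\subset\mathcal{DM}(N)$ is the set of separable density matrices, i.e. convex combinations of (finitely many) product density matrices. $\Sigma^k(n_1,\ldots,n_p)$ is the set of $A\in\Sigma(n_1,\ldots,n_p)$ that can be written as a convex combination of at most $k$ product density matrices. Measure is $(N^2-1)$-dimensional Lebesgue measure on the real affine hyperplane $\tau_1(N)$ of $N\times N$ complex Hermitian matrices of trace $1$ (which contains $\Sigma(n_1,\ldots,n_p)$); "open" means open in $\tau_1(N)$ (resp. relatively open in $\Sigma(n_1,\ldots,n_p)$ where stated). *)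

theory Defs
  imports "HOL-Analysis.Analysis"
begin

text \<open>Square complex matrices of size N are represented as functions
  nat => nat => complex whose entries outside the index range {..<N} x {..<N}
  are zero (so that equality of matrices is equality of functions).\<close>

type_synonym cmat = "nat \<Rightarrow> nat \<Rightarrow> complex"

definition sq_mats :: "nat \<Rightarrow> cmat set" where
  "sq_mats N = {A. \<forall>i j. \<not> (i < N \<and> j < N) \<longrightarrow> A i j = 0}"

definition hermitian_mat :: "nat \<Rightarrow> cmat \<Rightarrow> bool" where
  "hermitian_mat N A \<longleftrightarrow> (\<forall>i<N. \<forall>j<N. A j i = cnj (A i j))"

definition psd_mat :: "nat \<Rightarrow> cmat \<Rightarrow> bool" where
  "psd_mat N A \<longleftrightarrow>
     (\<forall>v :: nat \<Rightarrow> complex. 0 \<le> Re (\<Sum>i<N. \<Sum>j<N. cnj (v i) * A i j * v j))"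

definition mat_trace :: "nat \<Rightarrow> cmat \<Rightarrow> complex" where
  "mat_trace N A = (\<Sum>i<N. A i i)"

definition DM :: "nat \<Rightarrow> cmat set" where
  "DM w = {A \<in> sq_mats w. hermitian_mat w A \<and> psd_mat w A \<and> mat_trace w A = 1}"

text \<open>Kronecker product A (x) B where B is an m x m matrix (standard index
  convention: row (a,b) of A (x) B is a*m + b).\<close>
definition kron :: "nat \<Rightarrow> cmat \<Rightarrow> cmat \<Rightarrow> cmat" where
  "kron m A B = (\<lambda>i j. A (i div m) (j div m) * B (i mod m) (j mod m))"

fun tensor_list :: "(nat \<times> cmat) list \<Rightarrow> cmat" where
  "tensor_list [] = (\<lambda>i j. if i = 0 \<and> j = 0 then 1 else 0)"
| "tensor_list ((n, A) # rest) = kron (prod_list (map fst rest)) A (tensor_list rest)"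

definition product_DM :: "nat list \<Rightarrow> cmat set" where
  "product_DM ns = {tensor_list (zip ns As) | As.
      length As = length ns \<and> (\<forall>i<length ns. As ! i \<in> DM (ns ! i))}"

text \<open>Sigma^k: convex combinations of at most k product density matrices
  (written with exactly k terms, zero weights allowed).\<close>
definition Sigma_k :: "nat list \<Rightarrow> nat \<Rightarrow> cmat set" where
  "Sigma_k ns k = {A. \<exists>(c :: nat \<Rightarrow> real) (B :: nat \<Rightarrow> cmat).
      (\<forall>i<k. 0 \<le> c i \<and> B i \<in> product_DM ns) \<and> (\<Sum>i<k. c i) = 1 \<and>
      A = (\<lambda>a b. \<Sum>i<k. complex_of_real (c i) * B i a b)}"

definition Sigma_sep :: "nat list \<Rightarrow> cmat set" where
  "Sigma_sep ns = (\<Union>k. Sigma_k ns k)"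

text \<open>Real affine coordinates on the hyperplane tau_1(N) of trace-1 Hermitian
  N x N matrices: for t < N^2 - 1 with i = t div N, j = t mod N, the coordinate is
  Re A_ij if i <= j and Im A_ji if i > j.  (The omitted t = N^2 - 1 is the last
  diagonal entry, determined by the trace condition.)  This is an affine bijection
  of tau_1(N) onto R^(N^2-1) (functions in PiE {..<N^2-1} UNIV).\<close>
definition tau_coords :: "nat \<Rightarrow> cmat \<Rightarrow> (nat \<Rightarrow> real)" where
  "tau_coords N A = (\<lambda>t. if t < N^2 - 1 then
       (let i = t div N; j = t mod N in
          if i \<le> j then Re (A i j) else Im (A j i))
     else undefined)"

definition tau_lebesgue :: "nat \<Rightarrow> (nat \<Rightarrow> real) measure" where
  "tau_lebesgue N = PiM {..<N^2 - 1} (\<lambda>_. lborel)"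

definition tau_space :: "nat \<Rightarrow> (nat \<Rightarrow> real) set" where
  "tau_space N = PiE {..<N^2 - 1} (\<lambda>_. UNIV)"

end

theory Submission
  imports Defs
begin

text \<open>\<open>Sigma_k\<close> is the image, under a polynomial map, of a compact convex set of parameters
  (weights and tensor factors); this gives compactness and connectedness. The parameters have
  \<open>k - 1 + k * (\<Sum>j. n\<^sub>j\<^sup>2 - 1)\<close> real degrees of freedom, and the map is Lipschitz, so the image is null
  once this is below \<open>N\<^sup>2 - 1\<close>. For the last part, choose product density matrices
  \<open>D\<^sub>s\<close> on the first \<open>p - 1\<close> factors, as many as the product of their \<open>n\<^sub>j\<^sup>2\<close>, that span all
  matrices. Every Hermitian \<open>Z\<close> is then \<open>\<Sum>s. D\<^sub>s \<otimes> Y\<^sub>s\<close> with Hermitian \<open>Y\<^sub>s\<close> depending linearly on \<open>Z\<close>,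
  so a small traceless perturbation \<open>Z\<close> of \<open>\<Sum>s. D\<^sub>s \<otimes> r I\<close> is \<open>\<Sum>s. D\<^sub>s \<otimes> (r I + Y\<^sub>s)\<close>, in which
  the second factors are still positive.\<close>

section \<open>The hyperplane of trace-one Hermitian matrices and density matrices\<close>

text \<open>The hypothesis of (b) is k * (1 + \<Sum> (n_j^2 - 1)) < N^2. It becomes a strict
  comparison of dimensions only if each factor is measured by its n_j^2 - 1 affine coordinates
  rather than by its entries, and one weight is recovered from the others. Lipschitz estimates
  therefore have to pass from coordinates to entries and back, which is why an explicit inverse of
  \<open>tau_coords\<close> with a bound on its distortion is set up. In (c) the number of terms is
  the dimension of the complex matrices on the first p - 1 factors. Reading r I + Y_s as a state
  meets two obstacles. It must be Hermitian, which dictates a Hermitian choice of expansion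
  coefficients; and its trace depends on s. Dividing by the traces makes these the convex weights,
  and they add up to 1 because the perturbed matrix still has trace 1.\<close>

definition tau_mats :: "nat \<Rightarrow> cmat set" where
  "tau_mats N = {A \<in> sq_mats N. hermitian_mat N A \<and> mat_trace N A = 1}"

text \<open>The inverse of \<open>tau_coords\<close> for positive N: the omitted last diagonal entry
  is restored from the trace, and the lower triangle by conjugating the upper one.\<close>

definition tau_decode :: "nat \<Rightarrow> (nat \<Rightarrow> real) \<Rightarrow> cmat" where
  "tau_decode N x = (\<lambda>i j. if i < N \<and> j < N then
      (if i = j then (if i = N - 1 then 1 - (\<Sum>l<N-1. of_real (x (l * N + l))) else of_real (x (i * N + i)))
       else if i < j then Complex (x (i * N + j)) (x (j * N + i))
       else Complex (x (j * N + i)) (- x (i * N + j))) else 0)"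

lemma pair_index_less:
  fixes i j m n :: nat
  assumes "i < m" "j < n" shows "i * n + j < m * n"
proof -
  have "i * n + j < Suc i * n" using assms by simp
  also have "\<dots> \<le> m * n" using assms by (intro mult_right_mono) auto
  finally show ?thesis .
qed

text \<open>N^2 - 1 is the row-major index of the last diagonal position, and quotient and remainder
  by N show that no other position shares it. Every remaining position thus carries a genuine
  coordinate.\<close>

lemma tau_index_less:
  fixes i j N :: nat
  assumes "i < N" "j < N" "\<not> (i = N - 1 \<and> j = N - 1)"
  shows "i * N + j < N^2 - 1"
proof -
  have "i * N + j < N * N" by (rule pair_index_less) (use assms in auto)
  moreover have "i * N + j \<noteq> N * N - 1"
  proof
    assume eq: "i * N + j = N * N - 1"
    have "N * N - 1 = (N - 1) * N + (N - 1)" using assms by (cases N) auto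
    with eq have eq': "i * N + j = (N - 1) * N + (N - 1)" by simp
    have *: "(a * N + b) div N = a" "(a * N + b) mod N = b" if "b < N" for a b
      using that by auto
    have "i = N - 1" "j = N - 1"
      using eq' assms *[where a = i and b = j] *[where a = "N - 1" and b = "N - 1"] by simp_all
    then show False using assms by blast
  qed
  ultimately show ?thesis by (simp add: power2_eq_square)
qed

lemma tau_mats_entry_cnj:
  assumes "A \<in> tau_mats N" shows "A j i = cnj (A i j)"
proof (cases "i < N \<and> j < N")
  case True
  then show ?thesis using assms unfolding tau_mats_def hermitian_mat_def by blast
next
  case False
  then show ?thesis using assms by (auto simp: tau_mats_def sq_mats_def)
qed

lemma tau_coords_apply:
  assumes "i < N" "j < N" "\<not> (i = N - 1 \<and> j = N - 1)"
  shows "tau_coords N A (i * N + j) = (if i \<le> j then Re (A i j) else Im (A j i))"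
  using tau_index_less[OF assms] assms by (simp add: tau_coords_def)

lemma tau_decode_mem: assumes "0 < N" shows "tau_decode N x \<in> tau_mats N"
proof -
  have "(\<Sum>i<N. tau_decode N x i i) = (\<Sum>i<Suc (N-1). tau_decode N x i i)" using assms by simp
  also have "\<dots> = (\<Sum>i<N-1. tau_decode N x i i) + tau_decode N x (N-1) (N-1)"
    by (simp only: sum.lessThan_Suc)
  also have "(\<Sum>i<N-1. tau_decode N x i i) = (\<Sum>l<N-1. of_real (x (l * N + l)))"
    by (intro sum.cong) (auto simp: tau_decode_def)
  finally have "mat_trace N (tau_decode N x) = 1"
    using assms by (simp add: mat_trace_def tau_decode_def)
  then show ?thesis
    by (auto simp: tau_mats_def sq_mats_def hermitian_mat_def tau_decode_def complex_eq_iff)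
qed

lemma tau_coords_decode:
  assumes "0 < N" "x \<in> tau_space N" shows "tau_coords N (tau_decode N x) = x"
proof
  fix t
  show "tau_coords N (tau_decode N x) t = x t"
  proof (cases "t < N^2 - 1")
    case True
    define i j where "i = t div N" and "j = t mod N"
    have t: "t = i * N + j" by (simp add: i_def j_def)
    have "t < N * N" using True by (simp add: power2_eq_square)
    then have ij: "i < N" "j < N" using assms by (simp_all add: i_def j_def less_mult_imp_div_less)
    have "\<not> (i = N - 1 \<and> j = N - 1)"
    proof
      assume "i = N - 1 \<and> j = N - 1"
      then have "t = N^2 - 1" using t assms by (cases N) (auto simp: power2_eq_square)
      with True show False by simp
    qed
    then show ?thesis unfolding t using ij
      by (subst tau_coords_apply) (auto simp: tau_decode_def)
  next
    case False
    then show ?thesis using assms by (auto simp: tau_coords_def tau_space_def PiE_def extensional_def)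
  qed
qed

lemma tau_decode_coords:
  assumes "0 < N" "A \<in> tau_mats N" shows "tau_decode N (tau_coords N A) = A"
proof (intro ext)
  fix i j
  have diag: "of_real (Re (A l l)) = A l l" for l
    using tau_mats_entry_cnj[OF assms(2), of l l] by (simp add: complex_eq_iff)
  have "(\<Sum>l<N-1. of_real (tau_coords N A (l * N + l))) = (\<Sum>l<N-1. A l l)"
    by (intro sum.cong refl) (subst tau_coords_apply, auto simp: diag)
  moreover have "(\<Sum>l<N-1. A l l) + A (N-1) (N-1) = (\<Sum>l<Suc (N-1). A l l)"
    by (simp only: sum.lessThan_Suc)
  moreover have "\<dots> = 1" using assms by (simp add: tau_mats_def mat_trace_def)
  ultimately have last: "1 - (\<Sum>l<N-1. of_real (tau_coords N A (l * N + l))) = A (N-1) (N-1)"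
    by (simp add: algebra_simps)
  show "tau_decode N (tau_coords N A) i j = A i j"
  proof (cases "i < N \<and> j < N")
    case True
    then show ?thesis
      using last diag[of i] tau_mats_entry_cnj[OF assms(2), of i j]
      by (auto simp: tau_decode_def tau_coords_apply complex_eq_iff)
  next
    case False
    then show ?thesis using assms(2) by (auto simp: tau_decode_def tau_mats_def sq_mats_def)
  qed
qed

lemma inj_on_tau_coords: "0 < N \<Longrightarrow> inj_on (tau_coords N) (tau_mats N)"
  by (metis inj_onI tau_decode_coords)

lemma tau_coords_mem: "tau_coords N A \<in> tau_space N"
  by (simp add: tau_space_def PiE_iff extensional_def tau_coords_def)

text \<open>The constant covers the two expensive cases at once: the last diagonal entry accumulates
  N - 1 coordinate errors, and an off-diagonal entry suffers one error in its real and one in its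
  imaginary part.\<close>

lemma tau_decode_diff:
  assumes "\<And>t. t < N^2 - 1 \<Longrightarrow> \<bar>x t - y t\<bar> \<le> \<delta>" and "0 \<le> \<delta>"
  shows "cmod (tau_decode N x i j - tau_decode N y i j) \<le> (real N + 2) * \<delta>"
proof (cases "i < N \<and> j < N")
  case True
  have *: "\<bar>x (a * N + b) - y (a * N + b)\<bar> \<le> \<delta>"
    if "a < N" "b < N" "\<not> (a = N - 1 \<and> b = N - 1)" for a b
    using assms(1) tau_index_less[OF that] by blast
  have two: "2 * \<delta> \<le> (real N + 2) * \<delta>" and one: "\<delta> \<le> (real N + 2) * \<delta>"
    using assms(2) by (simp_all add: algebra_simps)
  consider "i = j" "i = N - 1" | "i = j" "i \<noteq> N - 1" | "i < j" | "j < i" by linarith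
  then show ?thesis
  proof cases
    case 1
    then have "cmod (tau_decode N x i j - tau_decode N y i j)
      = cmod (\<Sum>l<N-1. of_real (y (l * N + l) - x (l * N + l)))"
      using True by (simp add: tau_decode_def sum_subtractf)
    also have "\<dots> \<le> (\<Sum>l<N-1. \<delta>)"
      by (intro sum_norm_le) (use *[of l l for l] in \<open>auto simp del: of_real_diff simp: norm_of_real abs_minus_commute\<close>)
    also have "\<dots> \<le> (real N + 2) * \<delta>" using assms(2) by (auto intro!: mult_right_mono)
    finally show ?thesis .
  next
    case 2
    then have "cmod (tau_decode N x i j - tau_decode N y i j) = \<bar>x (i * N + i) - y (i * N + i)\<bar>"
      using True by (simp add: tau_decode_def flip: of_real_diff)
    then show ?thesis using *[of i i] 2 True one by auto
  next
    case 3
    then have "tau_decode N x i j - tau_decode N y i j =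
       Complex (x (i * N + j) - y (i * N + j)) (x (j * N + i) - y (j * N + i))"
      using True by (simp add: tau_decode_def complex_eq_iff)
    then show ?thesis using
      cmod_le[of "tau_decode N x i j - tau_decode N y i j"]
      *[of i j] *[of j i] 3 True two by auto
  next
    case 4
    then have "tau_decode N x i j - tau_decode N y i j =
       Complex (x (j * N + i) - y (j * N + i)) (y (i * N + j) - x (i * N + j))"
      using True by (simp add: tau_decode_def complex_eq_iff)
    then show ?thesis using
      cmod_le[of "tau_decode N x i j - tau_decode N y i j"]
      *[of i j] *[of j i] 4 True two by (auto simp: abs_minus_commute)
  qed
next
  case False
  then have "tau_decode N x i j = 0" "tau_decode N y i j = 0" by (auto simp: tau_decode_def)
  then show ?thesis using assms(2) by simp
qed

lemma tau_mats_diff: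
  assumes "0 < N" "A \<in> tau_mats N" "B \<in> tau_mats N" "0 \<le> \<delta>"
    and "\<And>t. t < N^2 - 1 \<Longrightarrow> \<bar>tau_coords N A t - tau_coords N B t\<bar> \<le> \<delta>"
  shows "cmod (A i j - B i j) \<le> (real N + 2) * \<delta>"
  using tau_decode_diff[of N "tau_coords N A" "tau_coords N B" \<delta> i j, OF assms(5,4)] assms(1-3) by (simp add: tau_decode_coords)

text \<open>No loss occurs in this direction, since a coordinate is the real or imaginary part of a
  single entry. Beyond the index range both sides are \<open>undefined\<close> and the difference is
  0.\<close>

lemma tau_coords_diff:
  assumes "\<And>i j. cmod (A i j - B i j) \<le> \<delta>" "0 \<le> \<delta>"
  shows "\<bar>tau_coords N A t - tau_coords N B t\<bar> \<le> \<delta>"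
  using assms(2) order_trans[OF abs_Re_le_cmod assms(1)] order_trans[OF abs_Im_le_cmod assms(1)]
  by (auto simp: tau_coords_def Let_def)

section \<open>Density matrices: entry bound, compactness and convexity\<close>

lemma DM_subset_tau_mats: "DM n \<subseteq> tau_mats n"
  by (auto simp: DM_def tau_mats_def)

text \<open>Lets positivity be tested on vectors supported at one or two indices, that is, on
  principal submatrices of size 1 and 2.\<close>

lemma quadratic_form_support:
  fixes v :: "nat \<Rightarrow> complex"
  assumes "S \<subseteq> {..<n}" "\<And>i. i \<notin> S \<Longrightarrow> v i = 0"
  shows "(\<Sum>i<n. \<Sum>j<n. cnj (v i) * A i j * v j) = (\<Sum>i\<in>S. \<Sum>j\<in>S. cnj (v i) * A i j * v j)"
proof -
  have "(\<Sum>i<n. \<Sum>j<n. cnj (v i) * A i j * v j) = (\<Sum>i<n. \<Sum>j\<in>S. cnj (v i) * A i j * v j)"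
    using assms by (intro sum.cong refl sum.mono_neutral_right) auto
  also have "\<dots> = (\<Sum>i\<in>S. \<Sum>j\<in>S. cnj (v i) * A i j * v j)"
    using assms by (intro sum.mono_neutral_right) auto
  finally show ?thesis .
qed

text \<open>Basis vectors show that the diagonal is nonnegative, and it sums to 1. Off the diagonal,
  a two-point test vector gives 2 |A_ij| \<le> A_ii + A_jj \<le> 1.\<close>

lemma DM_entry_le_1:
  assumes "A \<in> DM n" shows "cmod (A i j) \<le> 1"
proof (cases "i < n \<and> j < n")
  case False
  then show ?thesis using assms by (auto simp: DM_def sq_mats_def)
next
  case True
  have psd: "0 \<le> Re (\<Sum>a<n. \<Sum>b<n. cnj (v a) * A a b * v b)" for v
    using assms by (auto simp: DM_def psd_mat_def)
  have herm: "A b a = cnj (A a b)" for a b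
    using assms DM_subset_tau_mats tau_mats_entry_cnj by blast
  have diag: "0 \<le> Re (A a a)" if "a < n" for a
  proof -
    have "(\<Sum>c<n. \<Sum>d<n. cnj (of_bool (c = a)) * A c d * of_bool (d = a)) = A a a"
      using that by (subst quadratic_form_support[of "{a}"]) auto
    then show ?thesis using psd[of "\<lambda>c. of_bool (c = a)"] by simp
  qed
  have tr: "(\<Sum>a<n. Re (A a a)) = 1"
    using assms by (simp add: DM_def mat_trace_def flip: Re_sum)
  show ?thesis
  proof (cases "i = j")
    case True
    have "Re (A i i) \<le> (\<Sum>a<n. Re (A a a))"
      using \<open>i < n \<and> j < n\<close> diag by (intro member_le_sum) auto
    moreover have "A i i = of_real (Re (A i i))" using herm[of i i] by (simp add: complex_eq_iff)
    ultimately show ?thesis using tr diag[of i] \<open>i < n \<and> j < n\<close> True by (metis abs_of_nonneg norm_of_real)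
  next
    case False
    \<comment> \<open>A phase that turns the entry into a negative real, so that the two cross terms
      of the quadratic form add up to -2 |A_ij|.\<close>
    have "\<exists>w. cmod w = 1 \<and> w * A i j = - of_real (cmod (A i j))"
    proof (cases "A i j = 0")
      case True then show ?thesis by (intro exI[of _ 1]) auto
    next
      case nz: False
      then show ?thesis
        by (intro exI[of _ "- of_real (cmod (A i j)) / A i j"]) (auto simp: norm_divide)
    qed
    then obtain w where w: "cmod w = 1" "w * A i j = - of_real (cmod (A i j))" by blast
    define v where "v = (\<lambda>c. if c = i then 1 else if c = j then w else 0)"
    have cw: "cnj w * w = 1" using w(1) complex_norm_square[of w] by (simp add: mult.commute)
    have "(\<Sum>c<n. \<Sum>d<n. cnj (v c) * A c d * v d)
      = (A i i + A i j * w) + cnj w * (A j i + A j j * w)"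
      using \<open>i < n \<and> j < n\<close> False
      by (subst quadratic_form_support[of "{i, j}"]) (auto simp: v_def algebra_simps)
    also have "\<dots> = A i i + w * A i j + cnj (w * A i j) + A j j * (cnj w * w)"
      using herm[of i j] by (simp add: algebra_simps)
    finally have "0 \<le> Re (A i i) + Re (A j j) - 2 * cmod (A i j)"
      using psd[of v] by (simp add: w(2) cw)
    moreover have "(\<Sum>a\<in>{i,j}. Re (A a a)) \<le> (\<Sum>a<n. Re (A a a))"
      using \<open>i < n \<and> j < n\<close> diag by (intro sum_mono2) auto
    ultimately show ?thesis using tr False by simp
  qed
qed

lemma continuous_on_entry [continuous_intros]: "continuous_on S (\<lambda>A :: 'a \<Rightarrow> 'b \<Rightarrow> 'c::topological_space. A i j)"
proof -
  have "continuous_on S (\<lambda>A :: 'a \<Rightarrow> 'b \<Rightarrow> 'c. A i)"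
    by (rule continuous_on_subset[OF continuous_on_product_coordinates subset_UNIV])
  then show ?thesis by (rule continuous_on_product_then_coordinatewise)
qed

text \<open>Tychonoff's theorem, phrased for sets of total functions so that it can be applied again
  to each value when functions have several arguments.\<close>

lemma compact_fun:
  fixes S :: "'a \<Rightarrow> 'b::topological_space set"
  assumes "\<And>i. compact (S i)" shows "compact {f. \<forall>i. f i \<in> S i}"
proof -
  have "{f. \<forall>i. f i \<in> S i} = PiE UNIV S" by auto
  moreover have "compactin (product_topology (\<lambda>_. euclidean) UNIV) (PiE UNIV S)"
    using assms by (simp add: compactin_PiE)
  ultimately show ?thesis by (simp add: euclidean_product_topology)
qed

text \<open>The entry bound confines \<open>DM n\<close> to a product of unit discs, and each
  defining condition is closed because it only involves finite sums of entries or an intersection of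
  such conditions.\<close>

lemma compact_DM: "compact (DM n)"
proof -
  have 1: "closed (sq_mats n)"
    unfolding sq_mats_def
    by (intro closed_Collect_all closed_Collect_imp closed_Collect_eq continuous_intros open_Collect_const)
  have 2: "closed {A. hermitian_mat n A}" unfolding hermitian_mat_def
    by (intro closed_Collect_all closed_Collect_imp closed_Collect_eq continuous_intros open_Collect_const)
  have 3: "closed {A. psd_mat n A}" unfolding psd_mat_def
    by (intro closed_Collect_all closed_Collect_le continuous_intros)
  have 4: "closed {A. mat_trace n A = 1}" unfolding mat_trace_def
    by (intro closed_Collect_eq continuous_intros)
  have eq: "DM n = {A. \<forall>i. A i \<in> {f. \<forall>j. f j \<in> cball 0 1}} \<inter>
      (sq_mats n \<inter> {A. hermitian_mat n A} \<inter> {A. psd_mat n A} \<inter> {A. mat_trace n A = 1})"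
    using DM_entry_le_1 by (auto simp: DM_def)
  show ?thesis unfolding eq
    by (intro compact_Int_closed compact_fun closed_Int 1 2 3 4 compact_cball)
qed

text \<open>Convexity of each single factor is what allows two lists of factors to be joined by a
  path later.\<close>

lemma DM_convex:
  assumes "A \<in> DM n" "B \<in> DM n" "0 \<le> t" "t \<le> 1"
  shows "(\<lambda>i j. of_real (1 - t) * A i j + of_real t * B i j) \<in> DM n"
proof -
  have "Re (\<Sum>i<n. \<Sum>j<n. cnj (v i) * (of_real (1 - t) * A i j + of_real t * B i j) * v j)
    = (1 - t) * Re (\<Sum>i<n. \<Sum>j<n. cnj (v i) * A i j * v j)
      + t * Re (\<Sum>i<n. \<Sum>j<n. cnj (v i) * B i j * v j)" for v
  proof -
    have "(\<Sum>i<n. \<Sum>j<n. cnj (v i) * (of_real (1 - t) * A i j + of_real t * B i j) * v j)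
      = of_real (1 - t) * (\<Sum>i<n. \<Sum>j<n. cnj (v i) * A i j * v j)
      + of_real t * (\<Sum>i<n. \<Sum>j<n. cnj (v i) * B i j * v j)" (is "?s = of_real (1 - t) * ?a + of_real t * ?b")
      unfolding sum_distrib_left sum.distrib[symmetric]
      by (intro sum.cong refl) (simp add: algebra_simps)
    then have "Re ?s = Re (of_real (1 - t) * ?a + of_real t * ?b)" by (rule arg_cong)
    also have "\<dots> = (1 - t) * Re ?a + t * Re ?b"
      by (simp only: plus_complex.sel times_complex.sel Re_complex_of_real Im_complex_of_real
          mult_zero_left diff_zero)
    finally show ?thesis .
  qed
  then have "psd_mat n (\<lambda>i j. of_real (1 - t) * A i j + of_real t * B i j)"
    using assms by (simp add: DM_def psd_mat_def)
  moreover have "hermitian_mat n (\<lambda>i j. of_real (1 - t) * A i j + of_real t * B i j)"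
    unfolding hermitian_mat_def
  proof (intro allI impI)
    fix i j
    have "A j i = cnj (A i j)" "B j i = cnj (B i j)"
      using assms DM_subset_tau_mats tau_mats_entry_cnj by blast+
    then show "of_real (1 - t) * A j i + of_real t * B j i = cnj (of_real (1 - t) * A i j + of_real t * B i j)"
      by (simp only: complex_cnj_add complex_cnj_mult complex_cnj_complex_of_real)
  qed
  moreover have "mat_trace n (\<lambda>i j. of_real (1 - t) * A i j + of_real t * B i j)
      = of_real (1 - t) * mat_trace n A + of_real t * mat_trace n B"
    by (simp only: mat_trace_def sum.distrib sum_distrib_left)
  ultimately show ?thesis using assms by (simp add: DM_def sq_mats_def)
qed

section \<open>Tensor products and convex mixtures\<close>

text \<open>Reindexing by i = a * m + b. It splits traces of Kronecker products and, equally, sums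
  over families indexed by pairs.\<close>

lemma sum_div_mod:
  fixes f :: "nat \<Rightarrow> nat \<Rightarrow> 'a::comm_monoid_add"
  shows "(\<Sum>i<n * m. f (i div m) (i mod m)) = (\<Sum>a<n. \<Sum>b<m. f a b)"
proof -
  have "(\<Sum>i\<in>{a * m..<a * m + m}. f (i div m) (i mod m)) = (\<Sum>b<m. f a b)" for a
  proof -
    have "(\<Sum>i\<in>{a * m..<a * m + m}. f (i div m) (i mod m)) = (\<Sum>b\<in>{0..<m}. f ((b + a * m) div m) ((b + a * m) mod m))"
      using sum.shift_bounds_nat_ivl[of "\<lambda>i. f (i div m) (i mod m)" 0 "a * m" m] by (simp add: add.commute)
    also have "\<dots> = (\<Sum>b\<in>{0..<m}. f a b)" by (intro sum.cong) auto
    finally show ?thesis by (simp add: atLeast0LessThan)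
  qed
  then show ?thesis
    using sum.nat_group[of "\<lambda>i. f (i div m) (i mod m)" m n] by simp
qed

lemma sq_matsD: "A \<in> sq_mats n \<Longrightarrow> \<not> (i < n \<and> j < n) \<Longrightarrow> A i j = 0"
  unfolding sq_mats_def by blast

lemma kron_sq_mats:
  assumes "A \<in> sq_mats n" "0 < m" shows "kron m A B \<in> sq_mats (n * m)"
proof -
  have "kron m A B i j = 0" if "\<not> (i < n * m \<and> j < n * m)" for i j
  proof -
    have "\<not> (i div m < n \<and> j div m < n)"
      using that assms(2) by (simp add: div_less_iff_less_mult)
    then show ?thesis using sq_matsD[OF assms(1)] by (simp add: kron_def)
  qed
  then show ?thesis unfolding sq_mats_def by blast
qed

lemma tau_matsI:
  assumes "A \<in> sq_mats n" "\<And>i j. A j i = cnj (A i j)" "mat_trace n A = 1"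
  shows "A \<in> tau_mats n"
  unfolding tau_mats_def hermitian_mat_def using assms(1,3) assms(2) by blast

lemma mat_trace_kron: "mat_trace (n * m) (kron m A B) = mat_trace n A * mat_trace m B"
  unfolding mat_trace_def kron_def sum_product
  by (rule sum_div_mod[of "\<lambda>a b. A a a * B b b" m n])

lemma kron_tau_mats:
  assumes "A \<in> tau_mats n" "B \<in> tau_mats m" shows "kron m A B \<in> tau_mats (n * m)"
proof (rule tau_matsI)
  \<comment> \<open>Positivity of m comes from the trace of B: an empty trace would be 0, not
    1.\<close>
  show "kron m A B \<in> sq_mats (n * m)"
    using assms by (intro kron_sq_mats) (auto simp: tau_mats_def mat_trace_def intro: gr0I)
  show "kron m A B j i = cnj (kron m A B i j)" for i j
    unfolding kron_def complex_cnj_mult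
    using tau_mats_entry_cnj[OF assms(1)] tau_mats_entry_cnj[OF assms(2)] by metis
  show "mat_trace (n * m) (kron m A B) = 1"
    using assms by (simp add: mat_trace_kron tau_mats_def)
qed

lemma tensor_list_tau_mats:
  assumes "length As = length ns" "\<And>i. i < length ns \<Longrightarrow> As ! i \<in> tau_mats (ns ! i)"
  shows "tensor_list (zip ns As) \<in> tau_mats (prod_list ns)"
  using assms
proof (induction ns arbitrary: As)
  case Nil
  show ?case by (rule tau_matsI) (auto simp: sq_mats_def mat_trace_def)
next
  case (Cons n ns)
  from Cons.prems(1) obtain B Bs where As: "As = B # Bs" "length Bs = length ns"
    by (cases As) auto
  have "tensor_list (zip ns Bs) \<in> tau_mats (prod_list ns)"
    using Cons.IH[OF As(2)] Cons.prems(2)[of "Suc i" for i] As by simp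
  then show ?case using Cons.prems(2)[of 0] As by (simp add: kron_tau_mats)
qed

lemma product_DM_subset: "product_DM ns \<subseteq> tau_mats (prod_list ns)"
proof
  fix X assume "X \<in> product_DM ns"
  then obtain As where As: "X = tensor_list (zip ns As)" "length As = length ns"
    "\<forall>i<length ns. As ! i \<in> DM (ns ! i)" unfolding product_DM_def by blast
  then show "X \<in> tau_mats (prod_list ns)"
    using tensor_list_tau_mats[OF As(2)] DM_subset_tau_mats by blast
qed

text \<open>The mixed-radix digits of a row or column index of an iterated Kronecker product.\<close>

fun tensor_index :: "nat list \<Rightarrow> nat \<Rightarrow> nat \<Rightarrow> nat" where
  "tensor_index [] a j = 0"
| "tensor_index (n # ns) a 0 = a div prod_list ns"
| "tensor_index (n # ns) a (Suc j) = tensor_index ns (a mod prod_list ns) j"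

text \<open>An entry becomes a plain product of entries of the factors, ready for continuity and
  Lipschitz estimates. The factors form a function instead of a list, so that families of them live
  in a product space.\<close>

definition tensor_fam :: "nat list \<Rightarrow> (nat \<Rightarrow> cmat) \<Rightarrow> cmat" where
  "tensor_fam ns f = (\<lambda>a b. \<Prod>j<length ns. f j (tensor_index ns a j) (tensor_index ns b j))"

text \<open>The side condition reflects the only mismatch: with no factors the product is 1 at every
  position, whereas \<open>tensor_list []\<close> is 1 only at (0, 0).\<close>

lemma tensor_list_entry:
  assumes "length As = length ns" "ns = [] \<Longrightarrow> a = 0 \<and> b = 0"
  shows "tensor_list (zip ns As) a b = tensor_fam ns (nth As) a b"
  using assms
proof (induction ns arbitrary: As a b)
  case Nil
  then show ?case by (simp add: tensor_fam_def)
next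
  case (Cons n ns)
  from Cons.prems(1) obtain B Bs where As: "As = B # Bs" "length Bs = length ns"
    by (cases As) auto
  \<comment> \<open>If the tail is empty, its size is 1 and both remainders are 0, as the side
    condition of the induction hypothesis demands.\<close>
  have "tensor_list (zip ns Bs) (a mod prod_list ns) (b mod prod_list ns)
      = tensor_fam ns (nth Bs) (a mod prod_list ns) (b mod prod_list ns)"
    by (rule Cons.IH) (use As in auto)
  then show ?case using As
    by (simp add: kron_def tensor_fam_def prod.lessThan_Suc_shift del: prod.lessThan_Suc)
qed

lemma product_DM_eq:
  assumes "ns \<noteq> []"
  shows "product_DM ns = {tensor_fam ns f | f. \<forall>j<length ns. f j \<in> DM (ns ! j)}"
proof (intro subset_antisym subsetI)
  fix X assume "X \<in> product_DM ns"
  then obtain As where As: "X = tensor_list (zip ns As)" "length As = length ns"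
    "\<forall>i<length ns. As ! i \<in> DM (ns ! i)" unfolding product_DM_def by blast
  then have "X = tensor_fam ns (nth As)" using tensor_list_entry[OF As(2)] assms by blast
  then show "X \<in> {tensor_fam ns f | f. \<forall>j<length ns. f j \<in> DM (ns ! j)}" using As by blast
next
  fix X assume "X \<in> {tensor_fam ns f | f. \<forall>j<length ns. f j \<in> DM (ns ! j)}"
  then obtain f where f: "X = tensor_fam ns f" "\<forall>j<length ns. f j \<in> DM (ns ! j)" by blast
  let ?As = "map f [0..<length ns]"
  have "tensor_list (zip ns ?As) = X"
    using tensor_list_entry[of ?As ns] assms f by (auto simp: tensor_fam_def fun_eq_iff)
  then show "X \<in> product_DM ns" using f by (auto simp: product_DM_def intro!: exI[of _ ?As])
qed

text \<open>Slots that \<open>mixture\<close> never reads still have to range over compact convex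
  sets for the whole to be a compact product: surplus weights stay in [0, 1], surplus factors are
  pinned to the zero matrix.\<close>

definition mix_params :: "nat list \<Rightarrow> nat \<Rightarrow> ((nat \<Rightarrow> real) \<times> (nat \<Rightarrow> nat \<Rightarrow> cmat)) set" where
  "mix_params ns k = ({c. \<forall>i. c i \<in> {0..1}} \<inter> {c. (\<Sum>i<k. c i) = 1}) \<times>
     {f. \<forall>i. f i \<in> {g. \<forall>j. g j \<in> (if i < k \<and> j < length ns then DM (ns ! j) else {\<lambda>_ _. 0})}}"

definition mixture :: "nat list \<Rightarrow> nat \<Rightarrow> (nat \<Rightarrow> real) \<times> (nat \<Rightarrow> nat \<Rightarrow> cmat) \<Rightarrow> cmat" where
  "mixture ns k P = (\<lambda>a b. \<Sum>i<k. of_real (fst P i) * tensor_fam ns (snd P i) a b)"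

lemma mix_paramsD:
  assumes "P \<in> mix_params ns k"
  shows "0 \<le> fst P i" "fst P i \<le> 1" "(\<Sum>i<k. fst P i) = 1"
    "i < k \<Longrightarrow> j < length ns \<Longrightarrow> snd P i j \<in> DM (ns ! j)"
proof -
  show "0 \<le> fst P i" "fst P i \<le> 1" "(\<Sum>i<k. fst P i) = 1"
    using assms by (auto simp: mix_params_def)
  show "snd P i j \<in> DM (ns ! j)" if "i < k" "j < length ns"
  proof -
    have "snd P i j \<in> (if i < k \<and> j < length ns then DM (ns ! j) else {\<lambda>_ _. 0})"
      using assms unfolding mix_params_def mem_Times_iff mem_Collect_eq by blast
    then show ?thesis using that by simp
  qed
qed

lemma Sigma_k_eq:
  assumes "ns \<noteq> []" shows "Sigma_k ns k = mixture ns k ` mix_params ns k"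
proof (intro subset_antisym subsetI)
  fix X assume "X \<in> Sigma_k ns k"
  then obtain c B where cB: "\<And>i. i < k \<Longrightarrow> 0 \<le> c i" "\<And>i. i < k \<Longrightarrow> B i \<in> product_DM ns"
    "(\<Sum>i<k. c i) = 1" "X = (\<lambda>a b. \<Sum>i<k. complex_of_real (c i) * B i a b)"
    by (auto simp: Sigma_k_def)
  have "\<exists>f. B i = tensor_fam ns f \<and> (\<forall>j<length ns. f j \<in> DM (ns ! j))" if "i < k" for i
    using cB(2)[OF that] product_DM_eq[OF assms] by auto
  then obtain f where f: "\<And>i. i < k \<Longrightarrow> B i = tensor_fam ns (f i)"
    "\<And>i j. i < k \<Longrightarrow> j < length ns \<Longrightarrow> f i j \<in> DM (ns ! j)" by metis
  define P where "P = (\<lambda>i. if i < k then c i else 0,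
      \<lambda>i j. if i < k \<and> j < length ns then f i j else (\<lambda>_ _. 0))"
  have "c i \<le> 1" if "i < k" for i
    using cB(3) member_le_sum[of i "{..<k}" c] cB(1) that by auto
  then have "P \<in> mix_params ns k"
    using cB f unfolding mix_params_def P_def by auto
  moreover have "X = mixture ns k P"
    unfolding cB(4) mixture_def P_def
    by (intro ext sum.cong) (auto simp: f tensor_fam_def)
  ultimately show "X \<in> mixture ns k ` mix_params ns k" by blast
next
  fix X assume "X \<in> mixture ns k ` mix_params ns k"
  then obtain P where P: "P \<in> mix_params ns k" "X = mixture ns k P" by blast
  show "X \<in> Sigma_k ns k"
    unfolding Sigma_k_def mem_Collect_eq product_DM_eq[OF assms]
    by (rule exI[of _ "fst P"], rule exI[of _ "\<lambda>i. tensor_fam ns (snd P i)"])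
      (use mix_paramsD[OF P(1)] P(2) in \<open>auto simp: mixture_def\<close>)
qed

lemma Sigma_k_subset: "Sigma_k ns k \<subseteq> tau_mats (prod_list ns)"
proof
  fix X assume "X \<in> Sigma_k ns k"
  then obtain c B where cB: "\<And>i. i < k \<Longrightarrow> 0 \<le> c i" "\<And>i. i < k \<Longrightarrow> B i \<in> product_DM ns"
    "(\<Sum>i<k. c i) = 1" "X = (\<lambda>a b. \<Sum>i<k. complex_of_real (c i) * B i a b)"
    by (auto simp: Sigma_k_def)
  have B: "B i \<in> tau_mats (prod_list ns)" if "i < k" for i
    using cB(2)[OF that] product_DM_subset by blast
  show "X \<in> tau_mats (prod_list ns)"
  proof (rule tau_matsI)
    show "X \<in> sq_mats (prod_list ns)"
      using B by (auto simp: cB(4) sq_mats_def tau_mats_def)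
    show "X b a = cnj (X a b)" for a b
      unfolding cB(4) cnj_sum complex_cnj_mult complex_cnj_complex_of_real
      by (intro sum.cong refl) (metis B tau_mats_entry_cnj lessThan_iff)
    have "mat_trace (prod_list ns) X = (\<Sum>i<k. of_real (c i) * mat_trace (prod_list ns) (B i))"
      unfolding cB(4) mat_trace_def sum_distrib_left by (rule sum.swap)
    also have "\<dots> = (\<Sum>i<k. of_real (c i))"
      using B by (intro sum.cong) (auto simp: tau_mats_def)
    finally show "mat_trace (prod_list ns) X = 1" using cB(3) by (metis of_real_1 of_real_sum)
  qed
qed

lemma Sigma_k_subset_Sigma_sep: "Sigma_k ns k \<subseteq> Sigma_sep ns"
  by (auto simp: Sigma_sep_def)

lemma Sigma_sep_subset: "Sigma_sep ns \<subseteq> tau_mats (prod_list ns)"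
  using Sigma_k_subset by (auto simp: Sigma_sep_def)

section \<open>Compactness and connectedness of the set of k-term mixtures\<close>

lemma compact_mix_params: "compact (mix_params ns k)"
  unfolding mix_params_def
proof (intro compact_Times compact_Int_closed compact_fun)
  show "closed {c :: nat \<Rightarrow> real. (\<Sum>i<k. c i) = 1}"
    by (intro closed_Collect_eq continuous_intros continuous_on_product_coordinates)
qed (auto simp: compact_DM)

text \<open>The domain is left arbitrary so that the statement serves both the full parameter set
  (compactness) and a path of parameters (connectedness).\<close>

lemma continuous_on_mixture:
  assumes "\<And>i. continuous_on S (\<lambda>x. c x i)"
    and "\<And>i j a b. continuous_on S (\<lambda>x. f x i j a b)"
  shows "continuous_on S (\<lambda>x. mixture ns k (c x, f x) a b)"
  unfolding mixture_def tensor_fam_def fst_conv snd_conv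
  by (intro continuous_on_sum continuous_on_mult continuous_on_prod continuous_on_of_real assms)

lemma continuous_on_tau_coords:
  fixes F :: "'x::topological_space \<Rightarrow> cmat"
  assumes "\<And>a b. continuous_on S (\<lambda>x. F x a b)"
  shows "continuous_on S (\<lambda>x. tau_coords N (F x))"
proof (rule continuous_on_coordinatewise_then_product)
  fix t
  show "continuous_on S (\<lambda>x. tau_coords N (F x) t)"
    by (cases "t < N^2 - 1"; cases "t div N \<le> t mod N")
      (simp_all add: tau_coords_def Let_def continuous_on_Re continuous_on_Im assms)
qed

lemma continuous_on_entry4:
  "continuous_on S (\<lambda>f :: nat \<Rightarrow> nat \<Rightarrow> cmat. f i j a b)"
  by (intro continuous_on_product_then_coordinatewise[of S "\<lambda>f. f i j a"]
      continuous_on_product_then_coordinatewise[of S "\<lambda>f. f i j"] continuous_on_entry)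

lemma compact_tau_coords_Sigma_k:
  assumes "ns \<noteq> []" shows "compact (tau_coords N ` Sigma_k ns k)"
proof -
  have "continuous_on (mix_params ns k) (\<lambda>P. tau_coords N (mixture ns k (fst P, snd P)))"
  proof (intro continuous_on_tau_coords continuous_on_mixture)
    show "continuous_on (mix_params ns k) (\<lambda>P. fst P i)" for i
      by (rule continuous_on_product_then_coordinatewise[of _ fst]) (intro continuous_intros)
    show "continuous_on (mix_params ns k) (\<lambda>P. snd P i j a b)" for i j a b
      by (rule continuous_on_compose2[OF continuous_on_entry4[of UNIV]]) (intro continuous_intros | simp)+
  qed
  then show ?thesis
    using compact_continuous_image[OF _ compact_mix_params]
    by (simp add: Sigma_k_eq[OF assms] image_image)
qed

text \<open>A segment between two k-term mixtures may need more than k terms. The segment is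
  therefore taken in parameter space, moving the weights and every tensor factor separately, and
  then mapped by \<open>mixture\<close>.\<close>

lemma connected_tau_coords_Sigma_k:
  assumes "ns \<noteq> []" shows "connected (tau_coords N ` Sigma_k ns k)"
  unfolding connected_iff_connected_component
proof (intro ballI)
  fix x y assume "x \<in> tau_coords N ` Sigma_k ns k" "y \<in> tau_coords N ` Sigma_k ns k"
  then obtain P Q where P: "P \<in> mix_params ns k" "x = tau_coords N (mixture ns k P)"
    and Q: "Q \<in> mix_params ns k" "y = tau_coords N (mixture ns k Q)"
    by (auto simp: Sigma_k_eq[OF assms])
  define c where "c = (\<lambda>t i. (1 - t) * fst P i + t * fst Q i)"
  define f where "f = (\<lambda>t :: real. \<lambda>i j a b. of_real (1 - t) * snd P i j a b + of_real t * snd Q i j a b)"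
  let ?h = "\<lambda>t. tau_coords N (mixture ns k (c t, f t))"
  have "continuous_on {0..1} ?h"
    unfolding c_def f_def
    by (intro continuous_on_tau_coords continuous_on_mixture continuous_intros)
  then have "connected (?h ` {0..1})" by (intro connected_continuous_image) auto
  moreover have "?h 0 = x" "?h 1 = y" by (simp_all add: c_def f_def P Q)
  then have "x \<in> ?h ` {0..1}" "y \<in> ?h ` {0..1}" by force+
  moreover have "(c t, f t) \<in> mix_params ns k" if t: "t \<in> {0..1}" for t
  proof -
    have "(\<Sum>i<k. c t i) = (1 - t) * (\<Sum>i<k. fst P i) + t * (\<Sum>i<k. fst Q i)"
      by (simp add: c_def sum.distrib sum_distrib_left)
    moreover have "c t i \<in> {0..1}" for i
      using t mix_paramsD(1,2)[OF P(1), of i] mix_paramsD(1,2)[OF Q(1), of i]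
        convex_bound_le[of "fst P i" 1 "fst Q i" "1 - t" t] by (auto simp: c_def)
    moreover have "f t i j \<in> (if i < k \<and> j < length ns then DM (ns ! j) else {\<lambda>_ _. 0})" for i j
    proof (cases "i < k \<and> j < length ns")
      case True
      then show ?thesis
        using DM_convex[OF mix_paramsD(4)[OF P(1)] mix_paramsD(4)[OF Q(1)]] t by (simp add: f_def)
    next
      case False
      have "snd P i j \<in> (if i < k \<and> j < length ns then DM (ns ! j) else {\<lambda>_ _. 0})"
        "snd Q i j \<in> (if i < k \<and> j < length ns then DM (ns ! j) else {\<lambda>_ _. 0})"
        using P(1) Q(1) unfolding mix_params_def mem_Times_iff mem_Collect_eq by blast+
      then show ?thesis using False by (auto simp: f_def)
    qed
    ultimately show ?thesis
      using mix_paramsD(3)[OF P(1)] mix_paramsD(3)[OF Q(1)] by (simp add: mix_params_def)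
  qed
  then have "?h ` {0..1} \<subseteq> tau_coords N ` Sigma_k ns k"
    by (auto simp: Sigma_k_eq[OF assms])
  ultimately show "connected_component (tau_coords N ` Sigma_k ns k) x y"
    unfolding connected_component_def by blast
qed

section \<open>Null sets\<close>

text \<open>Closedness refers to the product topology on all functions, the measure to functions
  extensional on I. The inclusion of the latter is measurable, each coordinate being a projection or
  the constant \<open>undefined\<close>, and over a countable index type the product sigma-algebra
  is the Borel one.\<close>

lemma closed_imp_sets_PiM_lborel:
  fixes S :: "(nat \<Rightarrow> real) set"
  assumes "closed S" "S \<subseteq> PiE I (\<lambda>_. UNIV)"
  shows "S \<in> sets (PiM I (\<lambda>_. lborel))"
proof -
  have "(\<lambda>x. x) \<in> measurable (PiM I (\<lambda>_. lborel :: real measure)) (PiM UNIV (\<lambda>_. borel))"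
  proof (rule measurable_PiM_single')
    fix t :: nat
    show "(\<lambda>x. x t) \<in> borel_measurable (PiM I (\<lambda>_. lborel :: real measure))"
    proof (cases "t \<in> I")
      case True
      then show ?thesis
        using measurable_component_singleton[of t I "\<lambda>_. lborel :: real measure"] by simp
    next
      case False
      then have "(\<lambda>x. x t) \<in> borel_measurable (PiM I (\<lambda>_. lborel :: real measure)) \<longleftrightarrow>
          (\<lambda>x. undefined :: real) \<in> borel_measurable (PiM I (\<lambda>_. lborel :: real measure))"
        by (intro measurable_cong) (auto simp: space_PiM PiE_def extensional_def)
      then show ?thesis by simp
    qed
  qed auto
  moreover have "S \<in> sets (PiM UNIV (\<lambda>_. borel))"
    using assms(1) by (simp add: sets_PiM_equal_borel)
  ultimately have "(\<lambda>x. x) -` S \<inter> space (PiM I (\<lambda>_. lborel)) \<in> sets (PiM I (\<lambda>_. lborel))"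
    by (rule measurable_sets)
  moreover have "(\<lambda>x. x) -` S \<inter> space (PiM I (\<lambda>_. lborel :: real measure)) = S"
    using assms(2) by (auto simp: space_PiM)
  ultimately show ?thesis by simp
qed

lemma emeasure_PiM_lborel_cube:
  fixes x :: "'i \<Rightarrow> real"
  assumes "finite I" "0 \<le> r"
  shows "emeasure (PiM I (\<lambda>_. lborel)) (PiE I (\<lambda>t. {x t - r..x t + r})) = ennreal ((2 * r) ^ card I)"
proof -
  interpret product_sigma_finite "\<lambda>_. lborel :: real measure" by standard
  have "emeasure (PiM I (\<lambda>_. lborel)) (PiE I (\<lambda>t. {x t - r..x t + r}))
      = (\<Prod>t\<in>I. emeasure lborel {x t - r..x t + r})"
    by (rule emeasure_PiM) (use assms in auto)
  also have "\<dots> = (\<Prod>t\<in>I. ennreal (2 * r))" using assms by (intro prod.cong) auto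
  also have "\<dots> = ennreal ((2 * r) ^ card I)" using assms by (simp add: ennreal_power)
  finally show ?thesis .
qed

text \<open>Cutting the parameter cube into cells of side \<open>1/n\<close>, the image is covered by
  at most \<open>(2n+1)^card I\<close> cubes of side \<open>2L/n\<close>, of total volume \<open>O(1/n)\<close>.\<close>

lemma null_sets_lipschitz_image:
  fixes g :: "'p \<Rightarrow> 'i \<Rightarrow> real" and F :: "'p \<Rightarrow> nat \<Rightarrow> real"
  assumes fin: "finite I" and dim: "card I < M" and L: "0 \<le> L"
    and bound: "\<And>x i. x \<in> P \<Longrightarrow> i \<in> I \<Longrightarrow> \<bar>g x i\<bar> \<le> 1"
    and lip: "\<And>x y \<delta> t. x \<in> P \<Longrightarrow> y \<in> P \<Longrightarrow> 0 \<le> \<delta> \<Longrightarrow> (\<And>i. i \<in> I \<Longrightarrow> \<bar>g x i - g y i\<bar> \<le> \<delta>)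
      \<Longrightarrow> t < M \<Longrightarrow> \<bar>F x t - F y t\<bar> \<le> L * \<delta>"
    and ext: "\<And>x. x \<in> P \<Longrightarrow> F x \<in> PiE {..<M} (\<lambda>_. UNIV)"
    and sets: "F ` P \<in> sets (PiM {..<M} (\<lambda>_. lborel))"
  shows "F ` P \<in> null_sets (PiM {..<M} (\<lambda>_. lborel))"
proof -
  let ?\<mu> = "PiM {..<M} (\<lambda>_. lborel :: real measure)"
  define m where "m = card I"
  \<comment> \<open>The factor 3 per coordinate comes from 2n + 1 \<le> 3n, the factor 2L from the
    side 2L/n of a covering cube.\<close>
  define K where "K = 3 ^ m * (2 * L) ^ M"
  have K: "0 \<le> K" using L by (simp add: K_def)
  have le: "emeasure ?\<mu> (F ` P) \<le> ennreal (K / real n)" if n: "0 < n" for n :: nat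
  proof -
    define q where "q = (\<lambda>x. \<lambda>i\<in>I. \<lfloor>real n * g x i\<rfloor>)"
    have q: "q ` P \<subseteq> PiE I (\<lambda>_. {- int n..int n})"
    proof (rule image_subsetI)
      fix x assume x: "x \<in> P"
      have "- int n \<le> \<lfloor>real n * g x i\<rfloor> \<and> \<lfloor>real n * g x i\<rfloor> \<le> int n" if "i \<in> I" for i
      proof -
        have "\<bar>real n * g x i\<bar> \<le> real n"
          using bound[OF x that] n by (simp add: abs_mult mult_left_le)
        then have "- real n \<le> real n * g x i" "real n * g x i \<le> real n" by auto
        then show ?thesis by (simp add: le_floor_iff floor_le_iff)
      qed
      then show "q x \<in> PiE I (\<lambda>_. {- int n..int n})" by (auto simp: q_def)
    qed
    have finbox: "finite (PiE I (\<lambda>_. {- int n..int n}))" using fin by (intro finite_PiE) auto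
    have finq: "finite (q ` P)" using finite_subset[OF q finbox] .
    have "card (q ` P) \<le> card (PiE I (\<lambda>_. {- int n..int n}))" by (intro card_mono finbox q)
    also have "\<dots> = (2 * n + 1) ^ m" using fin by (simp add: card_PiE m_def nat_add_distrib nat_mult_distrib)
    also have "\<dots> \<le> (3 * n) ^ m" using n by (intro power_mono) auto
    finally have card: "real (card (q ` P)) \<le> real ((3 * n) ^ m)" by (simp only: of_nat_le_iff)
    \<comment> \<open>Only cells that meet P are used, each centred at the image of a point of P,
      because the Lipschitz bound is available between points of P alone.\<close>
    define rep where "rep = (\<lambda>v. SOME x. x \<in> P \<and> q x = v)"
    have rep: "rep v \<in> P \<and> q (rep v) = v" if "v \<in> q ` P" for v
      unfolding rep_def by (rule someI_ex) (use that in auto)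
    define box where "box = (\<lambda>v. PiE {..<M} (\<lambda>t. {F (rep v) t - L / n..F (rep v) t + L / n}))"
    have "F ` P \<subseteq> (\<Union>v\<in>q ` P. box v)"
    proof (rule image_subsetI)
      fix x assume x: "x \<in> P"
      let ?y = "rep (q x)"
      have y: "?y \<in> P" "q ?y = q x" using rep[of "q x"] x by auto
      have close: "\<bar>g x i - g ?y i\<bar> \<le> 1 / real n" if "i \<in> I" for i
      proof -
        have fl: "\<lfloor>real n * g x i\<rfloor> = \<lfloor>real n * g ?y i\<rfloor>"
          using fun_cong[OF y(2), of i] that by (simp add: q_def)
        have "\<bar>real n * g x i - real n * g ?y i\<bar> \<le> 1"
          using fl floor_correct[of "real n * g x i"] floor_correct[of "real n * g ?y i"] by linarith
        then have "real n * \<bar>g x i - g ?y i\<bar> \<le> 1"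
          by (simp add: abs_mult flip: right_diff_distrib)
        then show ?thesis using n by (simp add: field_simps)
      qed
      have "F x t \<in> {F ?y t - L / n..F ?y t + L / n}" if "t < M" for t
        using lip[OF x y(1) _ close that] n by (auto simp: abs_le_iff)
      then have "F x \<in> box (q x)" using ext[OF x] by (auto simp: box_def PiE_iff)
      then show "F x \<in> (\<Union>v\<in>q ` P. box v)" using x by blast
    qed
    moreover have box_sets: "box v \<in> sets ?\<mu>" for v
      unfolding box_def by (intro sets_PiM_I_finite) auto
    ultimately have "emeasure ?\<mu> (F ` P) \<le> emeasure ?\<mu> (\<Union>v\<in>q ` P. box v)"
      using finq by (intro emeasure_mono sets.finite_UN) auto
    also have "\<dots> \<le> (\<Sum>v\<in>q ` P. emeasure ?\<mu> (box v))"
      using finq box_sets by (intro emeasure_subadditive_finite) auto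
    also have "\<dots> = (\<Sum>v\<in>q ` P. ennreal ((2 * (L / n)) ^ M))"
      unfolding box_def using L by (subst emeasure_PiM_lborel_cube) auto
    also have "\<dots> = ennreal (real (card (q ` P)) * (2 * (L / n)) ^ M)"
      using L by (simp add: ennreal_mult ennreal_of_nat_eq_real_of_nat)
    also have "\<dots> \<le> ennreal (K / n)"
    proof (rule ennreal_leI)
      have "real (card (q ` P)) * (2 * (L / n)) ^ M \<le> real ((3 * n) ^ m) * (2 * (L / n)) ^ M"
        using card L by (intro mult_right_mono) auto
      also have "\<dots> = K * (real n ^ m / real n ^ M)"
        by (simp add: K_def power_mult_distrib power_divide)
      also have "\<dots> \<le> K * (1 / real n)"
      proof (intro mult_left_mono K)
        \<comment> \<open>Here \<open>card I < M\<close> enters: it leaves at least one power of n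
          to spare.\<close>
        have "real n ^ Suc m \<le> real n ^ M"
          using dim n by (intro power_increasing) (auto simp: m_def)
        then show "real n ^ m / real n ^ M \<le> 1 / real n" using n by (simp add: field_simps)
      qed
      finally show "real (card (q ` P)) * (2 * (L / n)) ^ M \<le> K / n" by simp
    qed
    finally show ?thesis .
  qed
  have "(\<lambda>n. K / real (Suc n)) \<longlonglongrightarrow> 0"
    using tendsto_mult_right_zero[OF LIMSEQ_inverse_real_of_nat, of K] by (simp add: divide_inverse)
  then have "(\<lambda>n. ennreal (K / real (Suc n))) \<longlonglongrightarrow> ennreal 0" by (rule tendsto_ennrealI)
  then have "emeasure ?\<mu> (F ` P) \<le> ennreal 0"
    by (rule LIMSEQ_le_const) (use le in blast)
  then show ?thesis using sets by (auto simp: null_sets_def)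
qed

section \<open>Lipschitz estimates for mixtures and the dimension count\<close>

lemma tensor_fam_le_1:
  assumes "\<And>j. j < length ns \<Longrightarrow> f j \<in> DM (ns ! j)"
  shows "cmod (tensor_fam ns f a b) \<le> 1"
  unfolding tensor_fam_def prod_norm[symmetric]
  using DM_entry_le_1[OF assms] by (intro prod_le_1) auto

text \<open>Exchanging the factors one at a time changes the product by at most \<delta> per factor,
  all other entries having modulus at most 1.\<close>

lemma tensor_fam_diff:
  assumes "\<And>j. j < length ns \<Longrightarrow> f j \<in> DM (ns ! j)" "\<And>j. j < length ns \<Longrightarrow> g j \<in> DM (ns ! j)"
    and "\<And>j a b. j < length ns \<Longrightarrow> cmod (f j a b - g j a b) \<le> \<delta>"
  shows "cmod (tensor_fam ns f a b - tensor_fam ns g a b) \<le> real (length ns) * \<delta>"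
proof -
  have "cmod (tensor_fam ns f a b - tensor_fam ns g a b) \<le>
    (\<Sum>j<length ns. cmod (f j (tensor_index ns a j) (tensor_index ns b j)
        - g j (tensor_index ns a j) (tensor_index ns b j)))"
    unfolding tensor_fam_def using DM_entry_le_1[OF assms(1)] DM_entry_le_1[OF assms(2)]
    by (intro norm_prod_diff) auto
  also have "\<dots> \<le> (\<Sum>j<length ns. \<delta>)" using assms(3) by (intro sum_mono) auto
  finally show ?thesis by simp
qed

text \<open>Only k - 1 weights are controlled: the last one is fixed by the sum being 1, and its
  error is at most the total error of the others, whence 2k. The difference splits as (c - d) S + d
  (S - T), where c, d are the weights and S, T the tensors of P and Q; the d sum to 1, so the tensor
  error is not multiplied by k.\<close>

lemma mixture_diff:
  assumes P: "P \<in> mix_params ns k" and Q: "Q \<in> mix_params ns k" and k: "0 < k"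
    and c: "\<And>i. i < k - 1 \<Longrightarrow> \<bar>fst P i - fst Q i\<bar> \<le> \<delta>" and "0 \<le> \<delta>"
    and f: "\<And>i j a b. i < k \<Longrightarrow> j < length ns \<Longrightarrow> cmod (snd P i j a b - snd Q i j a b) \<le> \<epsilon>"
  shows "cmod (mixture ns k P a b - mixture ns k Q a b) \<le> 2 * real k * \<delta> + real (length ns) * \<epsilon>"
proof -
  obtain l where l: "k = Suc l" using k by (cases k) auto
  let ?T = "\<lambda>i. tensor_fam ns (snd Q i) a b"
  have S: "cmod (tensor_fam ns (snd P i) a b) \<le> 1" if "i < k" for i
    using mix_paramsD(4)[OF P that] by (intro tensor_fam_le_1)
  have ST: "cmod (tensor_fam ns (snd P i) a b - ?T i) \<le> real (length ns) * \<epsilon>" if "i < k" for i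
    using mix_paramsD(4)[OF P that] mix_paramsD(4)[OF Q that] f[OF that] by (intro tensor_fam_diff)
  have first: "(\<Sum>i<l. \<bar>fst P i - fst Q i\<bar>) \<le> real k * \<delta>"
  proof -
    have "(\<Sum>i<l. \<bar>fst P i - fst Q i\<bar>) \<le> (\<Sum>i<l. \<delta>)" using c l by (intro sum_mono) auto
    also have "\<dots> \<le> real k * \<delta>" using l \<open>0 \<le> \<delta>\<close> by (simp add: mult_right_mono)
    finally show ?thesis .
  qed
  have "fst P l - fst Q l = (\<Sum>i<l. fst Q i - fst P i)"
    using mix_paramsD(3)[OF P] mix_paramsD(3)[OF Q] by (simp add: l sum_subtractf)
  then have "\<bar>fst P l - fst Q l\<bar> \<le> (\<Sum>i<l. \<bar>fst P i - fst Q i\<bar>)"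
    using sum_abs[of "\<lambda>i. fst Q i - fst P i" "{..<l}"] by (simp add: abs_minus_commute)
  then have weights: "(\<Sum>i<k. \<bar>fst P i - fst Q i\<bar>) \<le> 2 * real k * \<delta>"
    using first sum.lessThan_Suc[of "\<lambda>i. \<bar>fst P i - fst Q i\<bar>" l] by (simp add: l[symmetric])
  have eq: "mixture ns k P a b - mixture ns k Q a b
    = (\<Sum>i<k. of_real (fst P i - fst Q i) * tensor_fam ns (snd P i) a b
        + of_real (fst Q i) * (tensor_fam ns (snd P i) a b - ?T i))"
    unfolding mixture_def sum_subtractf[symmetric] by (intro sum.cong) (simp_all add: algebra_simps)
  have "cmod (mixture ns k P a b - mixture ns k Q a b)
    \<le> (\<Sum>i<k. \<bar>fst P i - fst Q i\<bar> + fst Q i * (real (length ns) * \<epsilon>))"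
    unfolding eq
  proof (intro sum_norm_le)
    fix i assume "i \<in> {..<k}"
    then have i: "i < k" by simp
    have "cmod (of_real (fst P i - fst Q i) * tensor_fam ns (snd P i) a b) \<le> \<bar>fst P i - fst Q i\<bar>"
      using S[OF i] unfolding norm_mult norm_of_real by (intro mult_left_le) auto
    moreover have "cmod (of_real (fst Q i) * (tensor_fam ns (snd P i) a b - ?T i))
        \<le> fst Q i * (real (length ns) * \<epsilon>)"
      using ST[OF i] mix_paramsD(1)[OF Q, of i] unfolding norm_mult norm_of_real
      by (simp add: mult_left_mono)
    ultimately show "cmod (of_real (fst P i - fst Q i) * tensor_fam ns (snd P i) a b
        + of_real (fst Q i) * (tensor_fam ns (snd P i) a b - ?T i))
        \<le> \<bar>fst P i - fst Q i\<bar> + fst Q i * (real (length ns) * \<epsilon>)"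
      by (intro norm_triangle_le add_mono)
  qed
  also have "\<dots> = (\<Sum>i<k. \<bar>fst P i - fst Q i\<bar>) + real (length ns) * \<epsilon>"
    unfolding sum.distrib sum_distrib_right[symmetric] mix_paramsD(3)[OF Q] by simp
  finally show ?thesis using weights by linarith
qed

lemma null_sets_tau_coords_Sigma_k:
  assumes ns: "ns \<noteq> []" "\<forall>n\<in>set ns. 0 < n" and k: "0 < k"
    and dim: "k * (1 + (\<Sum>j<length ns. (ns ! j)^2 - 1)) < (prod_list ns)^2"
  shows "tau_coords (prod_list ns) ` Sigma_k ns k \<in> null_sets (tau_lebesgue (prod_list ns))"
proof -
  let ?N = "prod_list ns" and ?p = "length ns"
  \<comment> \<open>The index set of the real parameters: k - 1 free weights, and for each of the k
    terms the n_j^2 - 1 coordinates of its j-th factor.\<close>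
  define I where "I = {..<k-1} <+> (SIGMA ij:{..<k} \<times> {..<?p}. {..<(ns ! snd ij)^2 - 1})"
  define g :: "(nat \<Rightarrow> real) \<times> (nat \<Rightarrow> nat \<Rightarrow> cmat) \<Rightarrow> nat + (nat \<times> nat) \<times> nat \<Rightarrow> real"
    where "g = (\<lambda>P s. case s of Inl i \<Rightarrow> fst P i
      | Inr ((i, j), t) \<Rightarrow> tau_coords (ns ! j) (snd P i j) t)"
  \<comment> \<open>The weights contribute 2k. Each of the p factors contributes the distortion n_j
    + 2 of decoding, with n_j bounded uniformly by the sum of all sizes.\<close>
  define L where "L = 2 * real k + real ?p * (real (sum_list ns) + 2)"
  have "(\<Sum>ij\<in>{..<k} \<times> {..<?p}. (ns ! snd ij)^2 - 1) = (\<Sum>i<k. \<Sum>j<?p. (ns ! j)^2 - 1)"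
    unfolding sum.cartesian_product by (simp add: case_prod_unfold)
  then have "card I = k - 1 + k * (\<Sum>j<?p. (ns ! j)^2 - 1)"
    unfolding I_def by (simp add: card_Plus card_SigmaI)
  then have cardI: "card I < ?N^2 - 1" using dim k by (simp add: algebra_simps)
  have nth_pos: "0 < ns ! j" if "j < ?p" for j using ns(2) that by simp
  have lip: "\<bar>tau_coords ?N (mixture ns k P) t - tau_coords ?N (mixture ns k Q) t\<bar> \<le> L * \<delta>"
    if P: "P \<in> mix_params ns k" and Q: "Q \<in> mix_params ns k" and \<delta>: "0 \<le> \<delta>"
      and gd: "\<And>s. s \<in> I \<Longrightarrow> \<bar>g P s - g Q s\<bar> \<le> \<delta>" for P Q \<delta> t
  proof (rule tau_coords_diff)
    fix a b
    have "cmod (mixture ns k P a b - mixture ns k Q a b)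
      \<le> 2 * real k * \<delta> + real ?p * ((real (sum_list ns) + 2) * \<delta>)"
    proof (rule mixture_diff[OF P Q k _ \<delta>])
      show "\<bar>fst P i - fst Q i\<bar> \<le> \<delta>" if "i < k - 1" for i
        using gd[of "Inl i"] that by (simp add: I_def g_def InlI)
      fix i j c d assume ij: "i < k" "j < ?p"
      have "cmod (snd P i j c d - snd Q i j c d) \<le> (real (ns ! j) + 2) * \<delta>"
      proof (rule tau_mats_diff[OF nth_pos[OF ij(2)] _ _ \<delta>])
        show "snd P i j \<in> tau_mats (ns ! j)" "snd Q i j \<in> tau_mats (ns ! j)"
          using mix_paramsD(4)[OF P ij] mix_paramsD(4)[OF Q ij] DM_subset_tau_mats by blast+
        show "\<bar>tau_coords (ns ! j) (snd P i j) t - tau_coords (ns ! j) (snd Q i j) t\<bar> \<le> \<delta>"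
          if "t < (ns ! j)^2 - 1" for t
          using gd[of "Inr ((i, j), t)"] that ij by (simp add: I_def g_def InrI)
      qed
      also have "\<dots> \<le> (real (sum_list ns) + 2) * \<delta>"
        using \<delta> elem_le_sum_list[OF ij(2)] by (intro mult_right_mono) auto
      finally show "cmod (snd P i j c d - snd Q i j c d) \<le> (real (sum_list ns) + 2) * \<delta>" .
    qed
    then show "cmod (mixture ns k P a b - mixture ns k Q a b) \<le> L * \<delta>"
      by (simp add: L_def algebra_simps)
  qed (use \<delta> in \<open>simp add: L_def\<close>)
  have bound: "\<bar>g P s\<bar> \<le> 1" if P: "P \<in> mix_params ns k" and s: "s \<in> I" for P s
  proof (cases s)
    case (Inl i)
    then show ?thesis using mix_paramsD(1,2)[OF P, of i] by (simp add: g_def)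
  next
    case (Inr r)
    obtain i j t where r: "r = ((i, j), t)" by (metis surj_pair)
    have ijt: "i < k" "j < ?p" "t < (ns ! j)^2 - 1" using s by (auto simp: Inr r I_def)
    have le: "cmod (snd P i j a b) \<le> 1" for a b
      using DM_entry_le_1[OF mix_paramsD(4)[OF P ijt(1,2)]] .
    then have "\<bar>Re (snd P i j a b)\<bar> \<le> 1" "\<bar>Im (snd P i j a b)\<bar> \<le> 1" for a b
      using order_trans[OF abs_Re_le_cmod le] order_trans[OF abs_Im_le_cmod le] by blast+
    then show ?thesis using ijt by (simp add: g_def Inr r tau_coords_def Let_def)
  qed
  have eq: "tau_coords ?N ` Sigma_k ns k = (\<lambda>P. tau_coords ?N (mixture ns k P)) ` mix_params ns k"
    by (simp add: Sigma_k_eq[OF ns(1)] image_image)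
  have "closed (tau_coords ?N ` Sigma_k ns k)"
    by (intro compact_imp_closed compact_tau_coords_Sigma_k ns(1))
  then have "tau_coords ?N ` Sigma_k ns k \<in> sets (PiM {..<?N^2-1} (\<lambda>_. lborel))"
    by (rule closed_imp_sets_PiM_lborel) (use tau_coords_mem in \<open>auto simp: tau_space_def\<close>)
  then show ?thesis
    unfolding tau_lebesgue_def eq
    by (intro null_sets_lipschitz_image[where I = I and g = g and L = L])
      (use cardI lip bound tau_coords_mem in \<open>auto simp: I_def L_def tau_space_def\<close>)
qed

section \<open>Spanning families of product density matrices\<close>

definition unit_mat :: "nat \<Rightarrow> nat \<Rightarrow> cmat" where
  "unit_mat a b = (\<lambda>i j. of_bool (i = a \<and> j = b))"

text \<open>Explicit coefficients are kept because they get multiplied across tensor factors and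
  symmetrised afterwards.\<close>

definition spanned :: "nat \<Rightarrow> (nat \<Rightarrow> cmat) \<Rightarrow> cmat \<Rightarrow> bool" where
  "spanned m D X \<longleftrightarrow> (\<exists>\<gamma>. \<forall>i j. X i j = (\<Sum>s<m. \<gamma> s * D s i j))"

lemma spanned_member:
  assumes "s < m" shows "spanned m D (D s)"
proof -
  have "D s i j = (\<Sum>t<m. of_bool (t = s) * D t i j)" for i j
  proof -
    have "(\<Sum>t<m. of_bool (t = s) * D t i j) = (\<Sum>t<m. if t = s then D t i j else 0)"
      by (intro sum.cong) auto
    then show ?thesis using assms by simp
  qed
  then show ?thesis unfolding spanned_def by (intro exI[of _ "\<lambda>t. of_bool (t = s)"]) blast
qed

lemma spanned_linear:
  assumes "spanned m D X" "spanned m D Y"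
  shows "spanned m D (\<lambda>i j. c * X i j + d * Y i j)"
proof -
  obtain \<gamma> \<delta> where "\<And>i j. X i j = (\<Sum>s<m. \<gamma> s * D s i j)" "\<And>i j. Y i j = (\<Sum>s<m. \<delta> s * D s i j)"
    using assms unfolding spanned_def by blast
  then have "c * X i j + d * Y i j = (\<Sum>s<m. (c * \<gamma> s + d * \<delta> s) * D s i j)" for i j
    by (simp add: sum_distrib_left sum.distrib[symmetric] algebra_simps)
  then show ?thesis unfolding spanned_def by (intro exI[of _ "\<lambda>s. c * \<gamma> s + d * \<delta> s"]) blast
qed

definition pure_state :: "nat \<Rightarrow> (nat \<Rightarrow> complex) \<Rightarrow> cmat" where
  "pure_state n u = (\<lambda>i j. if i < n \<and> j < n then u i * cnj (u j) else 0)"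

lemma pure_state_DM:
  assumes "(\<Sum>i<n. (cmod (u i))\<^sup>2) = 1" shows "pure_state n u \<in> DM n"
proof -
  have "(\<Sum>i<n. \<Sum>j<n. cnj (v i) * pure_state n u i j * v j)
      = (\<Sum>i<n. cnj (v i) * u i) * cnj (\<Sum>i<n. cnj (v i) * u i)" for v
    unfolding cnj_sum sum_product
    by (intro sum.cong refl) (auto simp: pure_state_def algebra_simps)
  then have "psd_mat n (pure_state n u)"
    by (simp add: psd_mat_def complex_mult_cnj del: cnj_sum)
  moreover have "mat_trace n (pure_state n u) = of_real (\<Sum>i<n. (cmod (u i))\<^sup>2)"
    by (simp add: mat_trace_def pure_state_def complex_norm_square del: of_real_power)
  ultimately show ?thesis using assms
    by (simp add: DM_def sq_mats_def hermitian_mat_def pure_state_def)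
qed

text \<open>Polarisation: the pure state of (e_a + w e_b) / sqrt 2 is half the sum of the diagonal
  units at a and b, of \<open>cnj w\<close> times the unit at (a, b) and of w times the unit at (b,
  a). Taking w = 1 and w = \<i> separates the off-diagonal units.\<close>

lemma spanning_density_matrices:
  assumes "0 < n"
  obtains D where "\<And>s. s < n^2 \<Longrightarrow> D s \<in> DM n"
    "\<And>a b. a < n \<Longrightarrow> b < n \<Longrightarrow> spanned (n^2) D (unit_mat a b)"
proof -
  \<comment> \<open>For \<open>a < b\<close> the states of index \<open>(a, b)\<close> and \<open>(b, a)\<close> capture the real and the imaginary
    part of the entry at \<open>(a, b)\<close>.\<close>
  define w where "w = (\<lambda>a b :: nat. if a < b then 1 else \<i>)"
  define u where "u = (\<lambda>a b i :: nat. if a = b then of_bool (i = a)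
      else (of_bool (i = a) + w a b * of_bool (i = b)) / complex_of_real (sqrt 2))"
  define E where "E = (\<lambda>a b. pure_state n (u a b))"
  define D where "D = (\<lambda>s. E (s div n) (s mod n))"
  have w: "cmod (w a b) = 1" for a b by (simp add: w_def)
  have E: "E a b \<in> DM n" if "a < n" "b < n" for a b
    unfolding E_def
  proof (rule pure_state_DM)
    have "(\<Sum>i<n. (cmod (u a b i))\<^sup>2) = (\<Sum>i\<in>{a, b}. (cmod (u a b i))\<^sup>2)"
      using that by (intro sum.mono_neutral_right) (auto simp: u_def)
    also have "\<dots> = 1"
      by (cases "a = b") (simp_all add: u_def w norm_divide power_divide)
    finally show "(\<Sum>i<n. (cmod (u a b i))\<^sup>2) = 1" .
  qed
  have D_index: "D (a * n + b) = E a b" if "b < n" for a b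
    using that by (simp add: D_def)
  have spE: "spanned (n^2) D (E a b)" if "a < n" "b < n" for a b
    using spanned_member[of "a * n + b" "n^2" D] pair_index_less[OF that] D_index[OF that(2)]
    by (simp add: power2_eq_square)
  have diag: "E a a = unit_mat a a" if "a < n" for a
    using that by (auto simp: E_def pure_state_def u_def unit_mat_def fun_eq_iff)
  have spd: "spanned (n^2) D (unit_mat a a)" if "a < n" for a
    using spE[OF that that] diag[OF that] by simp
  have sq2: "complex_of_real (sqrt 2) * complex_of_real (sqrt 2) = 2"
    by (metis abs_numeral of_real_mult of_real_numeral real_sqrt_abs2 real_sqrt_mult)
  have entry: "E a b i j = (if a = b then of_bool (i = a) * of_bool (j = a)
      else (of_bool (i = a) + w a b * of_bool (i = b)) * (of_bool (j = a) + cnj (w a b) * of_bool (j = b)) / 2)"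
    if "a < n" "b < n" for a b i j
    using that by (auto simp: E_def pure_state_def u_def sq2)
  have sp: "spanned (n^2) D (unit_mat a b) \<and> spanned (n^2) D (unit_mat b a)"
    if ab: "a < b" "a < n" "b < n" for a b
  proof -
    \<comment> \<open>Adding -\<i> or \<i> times the second state cancels one of the off-diagonal
      units; the last bracket removes the diagonal that remains. The factors 1 give the right-hand
      side the shape of \<open>spanned_linear\<close>.\<close>
    have eq1: "unit_mat a b = (\<lambda>i j. 1 * (1 * E a b i j + (- \<i>) * E b a i j)
        + ((- 1 + \<i>) / 2) * (1 * unit_mat a a i j + 1 * unit_mat b b i j))"
      using ab by (intro ext) (auto simp: entry unit_mat_def w_def complex_eq_iff of_bool_def)
    have eq2: "unit_mat b a = (\<lambda>i j. 1 * (1 * E a b i j + \<i> * E b a i j)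
        + ((- 1 - \<i>) / 2) * (1 * unit_mat a a i j + 1 * unit_mat b b i j))"
      using ab by (intro ext) (auto simp: entry unit_mat_def w_def complex_eq_iff of_bool_def)
    show ?thesis
      unfolding eq1 eq2 by (intro conjI spanned_linear spE spd ab)
  qed
  show thesis
  proof
    show "D s \<in> DM n" if "s < n^2" for s
      using that assms unfolding D_def
      by (intro E) (simp_all add: power2_eq_square less_mult_imp_div_less)
    show "spanned (n^2) D (unit_mat a b)" if "a < n" "b < n" for a b
      using sp[of a b] sp[of b a] spd[of a] that by (cases a b rule: linorder_cases) auto
  qed
qed

lemma kron_product_DM_Cons:
  assumes "A \<in> DM n" "B \<in> product_DM ns"
  shows "kron (prod_list ns) A B \<in> product_DM (n # ns)"
proof -
  obtain Bs where Bs: "B = tensor_list (zip ns Bs)" "length Bs = length ns"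
    "\<forall>i<length ns. Bs ! i \<in> DM (ns ! i)" using assms(2) unfolding product_DM_def by blast
  have "kron (prod_list ns) A B = tensor_list (zip (n # ns) (A # Bs))"
    by (simp add: Bs)
  moreover have "\<forall>i<length (n # ns). (A # Bs) ! i \<in> DM ((n # ns) ! i)"
    using Bs(3) assms(1) by (auto simp: nth_Cons split: nat.split)
  moreover have "length (A # Bs) = length (n # ns)" using Bs(2) by simp
  ultimately show ?thesis unfolding product_DM_def by blast
qed

lemma kron_assoc: "kron (m * q) A (kron q T B) = kron q (kron m A T) B"
proof (intro ext)
  fix i j
  have "i mod (m * q) div q = i div q mod m" "i mod (m * q) mod q = i mod q" for i
    by (cases "q = 0", auto simp: mult.commute[of m q] mod_mult2_eq)+
  then show "kron (m * q) A (kron q T B) i j = kron q (kron m A T) B i j"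
    by (simp add: kron_def mult.commute[of m q] div_mult2_eq)
qed

text \<open>\<open>tensor_list\<close> grows at the head, but the interior argument singles out the
  last factor; associativity of \<open>kron\<close> carries it through the induction.\<close>

lemma kron_product_DM_snoc:
  assumes "A \<in> product_DM ms" "B \<in> DM q"
  shows "kron q A B \<in> product_DM (ms @ [q])"
proof -
  obtain As where As: "A = tensor_list (zip ms As)" "length As = length ms"
    "\<forall>i<length ms. As ! i \<in> DM (ms ! i)" using assms(1) unfolding product_DM_def by blast
  have B: "B \<in> sq_mats q" using assms(2) by (simp add: DM_def)
  have "kron q (tensor_list (zip ms As)) B = tensor_list (zip (ms @ [q]) (As @ [B]))"
    using As(2)
  proof (induction ms arbitrary: As)
    case Nil
    \<comment> \<open>Both sides equal B: off the q x q corner the left one vanishes because the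
      empty tensor lives at (0, 0), the right one because B does. For q = 0 all quotients are 0, but
      then B is zero.\<close>
    have "kron q (tensor_list []) B i j = kron 1 B (tensor_list []) i j" for i j
    proof (cases "i < q \<and> j < q")
      case True
      then show ?thesis by (simp add: kron_def)
    next
      case False
      have "\<not> (i div q = 0 \<and> j div q = 0) \<or> q = 0"
        using False by (auto simp: div_eq_0_iff)
      then show ?thesis using sq_matsD[OF B False] sq_matsD[OF B, of i j] sq_matsD[OF B] by (auto simp: kron_def)
    qed
    then show ?case using Nil by (simp add: fun_eq_iff)
  next
    case (Cons m ms)
    then obtain C Cs where "As = C # Cs" "length Cs = length ms" by (cases As) auto
    then show ?case using Cons.IH[of Cs] by (simp flip: kron_assoc)
  qed
  moreover have "\<forall>i<length (ms @ [q]). (As @ [B]) ! i \<in> DM ((ms @ [q]) ! i)"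
    using As(2,3) assms(2) by (auto simp: nth_append less_Suc_eq)
  moreover have "length (As @ [B]) = length (ms @ [q])" using As(2) by simp
  ultimately show ?thesis unfolding product_DM_def As(1) by blast
qed

text \<open>A matrix unit is the Kronecker product of the units at the quotients and at the
  remainders of its indices, so coefficients of the two families multiply.\<close>

lemma spanning_product_DM:
  assumes "\<forall>n\<in>set ns. 0 < n"
  shows "\<exists>D. (\<forall>s<prod_list (map (\<lambda>n. n^2) ns). D s \<in> product_DM ns) \<and>
    (\<forall>a<prod_list ns. \<forall>b<prod_list ns. spanned (prod_list (map (\<lambda>n. n^2) ns)) D (unit_mat a b))"
  using assms
proof (induction ns)
  case Nil
  have "spanned 1 (\<lambda>_. tensor_list []) (unit_mat 0 0)"
    using spanned_member[of 0 1 "\<lambda>_. tensor_list []"]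
    by (simp add: unit_mat_def of_bool_def)
  then show ?case by (intro exI[of _ "\<lambda>_. tensor_list []"]) (auto simp: product_DM_def)
next
  case (Cons n ns)
  let ?M = "prod_list ns" and ?m = "prod_list (map (\<lambda>n. n^2) ns)"
  obtain D where D: "\<And>s. s < n^2 \<Longrightarrow> D s \<in> DM n"
    "\<And>a b. a < n \<Longrightarrow> b < n \<Longrightarrow> spanned (n^2) D (unit_mat a b)"
    using spanning_density_matrices[of n] Cons.prems by auto
  obtain F where F: "\<And>s. s < ?m \<Longrightarrow> F s \<in> product_DM ns"
    "\<And>a b. a < ?M \<Longrightarrow> b < ?M \<Longrightarrow> spanned ?m F (unit_mat a b)"
  proof -
    have "\<forall>n\<in>set ns. 0 < n" using Cons.prems by simp
    from Cons.IH[OF this] show ?thesis using that by blast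
  qed
  define G where "G = (\<lambda>s. kron ?M (D (s div ?m)) (F (s mod ?m)))"
  have M: "0 < ?M" using Cons.prems by (induction ns) auto
  have m: "0 < ?m" using Cons.prems by (induction ns) auto
  have "G s \<in> product_DM (n # ns)" if "s < n^2 * ?m" for s
    unfolding G_def using that m
    by (intro kron_product_DM_Cons D F) (auto simp: less_mult_imp_div_less)
  moreover have "spanned (n^2 * ?m) G (unit_mat a b)" if ab: "a < n * ?M" "b < n * ?M" for a b
  proof -
    obtain \<gamma> where \<gamma>: "\<And>i j. unit_mat (a div ?M) (b div ?M) i j = (\<Sum>s<n^2. \<gamma> s * D s i j)"
      using D(2)[of "a div ?M" "b div ?M"] ab unfolding spanned_def
      by (auto simp: less_mult_imp_div_less)
    obtain \<delta> where \<delta>: "\<And>i j. unit_mat (a mod ?M) (b mod ?M) i j = (\<Sum>s<?m. \<delta> s * F s i j)"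
      using F(2)[of "a mod ?M" "b mod ?M"] M unfolding spanned_def by auto
    have "unit_mat a b i j = (\<Sum>s<n^2 * ?m. \<gamma> (s div ?m) * \<delta> (s mod ?m) * G s i j)" for i j
    proof -
      have "(\<Sum>s<n^2 * ?m. \<gamma> (s div ?m) * \<delta> (s mod ?m) * G s i j)
        = (\<Sum>s<n^2. \<Sum>t<?m. \<gamma> s * \<delta> t * (D s (i div ?M) (j div ?M) * F t (i mod ?M) (j mod ?M)))"
        unfolding G_def kron_def
        by (rule sum_div_mod[of "\<lambda>s t. \<gamma> s * \<delta> t * (D s (i div ?M) (j div ?M) * F t (i mod ?M) (j mod ?M))"])
      also have "\<dots> = unit_mat (a div ?M) (b div ?M) (i div ?M) (j div ?M)
          * unit_mat (a mod ?M) (b mod ?M) (i mod ?M) (j mod ?M)"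
        unfolding \<gamma> \<delta> sum_product by (intro sum.cong refl) (simp add: algebra_simps)
      also have "\<dots> = unit_mat a b i j"
      proof -
        have "c = d \<longleftrightarrow> c div ?M = d div ?M \<and> c mod ?M = d mod ?M" for c d
          by (metis div_mult_mod_eq)
        then show ?thesis unfolding unit_mat_def of_bool_def by (smt (verit) mult_1 mult_zero_left mult_zero_right)
      qed
      finally show ?thesis by simp
    qed
    then show ?thesis unfolding spanned_def
      by (intro exI[of _ "\<lambda>s. \<gamma> (s div ?m) * \<delta> (s mod ?m)"]) blast
  qed
  ultimately show ?case by (intro exI[of _ G]) auto
qed

section \<open>Interior points\<close>

text \<open>The symmetry of \<open>\<gamma>\<close> ensures that contracting the blocks of a
  Hermitian matrix with \<open>\<gamma> s\<close> gives a Hermitian matrix. It can be arranged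
  because the conjugate transpose of an expansion of the unit at (b, a) expands the unit at (a,
  b).\<close>

lemma hermitian_spanning_product_DM:
  assumes "\<forall>n\<in>set ns. 0 < n"
  shows "\<exists>D \<gamma>. (\<forall>s<prod_list (map (\<lambda>n. n^2) ns). D s \<in> product_DM ns) \<and>
    (\<forall>s a b. \<gamma> s b a = cnj (\<gamma> s a b)) \<and>
    (\<forall>a<prod_list ns. \<forall>b<prod_list ns. \<forall>i j.
       (\<Sum>s<prod_list (map (\<lambda>n. n^2) ns). \<gamma> s a b * D s i j) = unit_mat a b i j)"
proof -
  let ?m = "prod_list (map (\<lambda>n. n^2) ns)" and ?M = "prod_list ns"
  obtain D where D: "\<And>s. s < ?m \<Longrightarrow> D s \<in> product_DM ns"
    "\<And>a b. a < ?M \<Longrightarrow> b < ?M \<Longrightarrow> spanned ?m D (unit_mat a b)"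
    using spanning_product_DM[OF assms] by blast
  from D(2) obtain \<delta> where \<delta>: "\<And>a b i j. a < ?M \<Longrightarrow> b < ?M \<Longrightarrow>
      unit_mat a b i j = (\<Sum>s<?m. \<delta> a b s * D s i j)"
    unfolding spanned_def by metis
  have herm: "D s i j = cnj (D s j i)" if "s < ?m" for s i j
    using D(1)[OF that] product_DM_subset tau_mats_entry_cnj by blast
  \<comment> \<open>Symmetrising the coefficients makes them Hermitian without having to know that the \<open>D s\<close>
    are linearly independent.\<close>
  define \<gamma> where "\<gamma> = (\<lambda>s a b. (\<delta> a b s + cnj (\<delta> b a s)) / 2)"
  have "(\<Sum>s<?m. \<gamma> s a b * D s i j) = unit_mat a b i j" if ab: "a < ?M" "b < ?M" for a b i j
  proof -
    have "(\<Sum>s<?m. cnj (\<delta> b a s) * D s i j) = cnj (\<Sum>s<?m. \<delta> b a s * D s j i)"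
      unfolding cnj_sum complex_cnj_mult
      by (intro sum.cong refl) (metis herm lessThan_iff)
    also have "\<dots> = cnj (unit_mat b a j i)" by (simp only: \<delta>[OF ab(2,1)])
    also have "\<dots> = unit_mat a b i j" by (auto simp: unit_mat_def)
    finally have conj: "(\<Sum>s<?m. cnj (\<delta> b a s) * D s i j) = unit_mat a b i j" .
    have "(\<Sum>s<?m. \<gamma> s a b * D s i j)
        = ((\<Sum>s<?m. \<delta> a b s * D s i j) + (\<Sum>s<?m. cnj (\<delta> b a s) * D s i j)) / 2"
      unfolding \<gamma>_def sum.distrib[symmetric] sum_divide_distrib
      by (intro sum.cong refl) (simp add: algebra_simps)
    then show ?thesis using conj \<delta>[OF ab, of i j] by simp
  qed
  moreover have "\<gamma> s b a = cnj (\<gamma> s a b)" for s a b by (simp add: \<gamma>_def add.commute)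
  ultimately show ?thesis using D(1) by (intro exI[of _ D] exI[of _ \<gamma>] conjI) blast+
qed

text \<open>Since |v_i| |v_j| is at most the mean of the two squares, entries of modulus at most r/q
  give a quadratic form bounded by r times the squared norm of v, which the scalar part
  absorbs.\<close>

lemma psd_mat_diagonally_perturbed:
  assumes "\<And>i j. i < q \<Longrightarrow> j < q \<Longrightarrow> real q * cmod (Y i j) \<le> r"
  shows "psd_mat q (\<lambda>i j. (if i < q \<and> i = j then of_real r else 0) + Y i j)"
  unfolding psd_mat_def
proof
  fix v :: "nat \<Rightarrow> complex"
  let ?W = "\<lambda>i j. (if i < q \<and> i = j then of_real r else 0) + Y i j"
  let ?n = "\<Sum>i<q. (cmod (v i))\<^sup>2"
  have "(\<Sum>i<q. \<Sum>j<q. cnj (v i) * ?W i j * v j)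
      = (\<Sum>i<q. (\<Sum>j<q. (if j = i then of_real r * (cnj (v i) * v j) else 0)) + (\<Sum>j<q. cnj (v i) * Y i j * v j))"
    unfolding sum.distrib[symmetric]
    by (intro sum.cong refl) (auto simp: algebra_simps)
  also have "\<dots> = (\<Sum>i<q. of_real (r * (cmod (v i))\<^sup>2)) + (\<Sum>i<q. \<Sum>j<q. cnj (v i) * Y i j * v j)"
    unfolding sum.distrib
    by (intro arg_cong2[where f = "(+)"] sum.cong refl)
      (simp add: complex_norm_square mult.commute del: of_real_power)
  finally have split: "Re (\<Sum>i<q. \<Sum>j<q. cnj (v i) * ?W i j * v j)
      = r * ?n + Re (\<Sum>i<q. \<Sum>j<q. cnj (v i) * Y i j * v j)"
    by (simp add: sum_distrib_left)
  have "cmod (\<Sum>i<q. \<Sum>j<q. cnj (v i) * Y i j * v j)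
      \<le> (\<Sum>i<q. \<Sum>j<q. r / real q * (((cmod (v i))\<^sup>2 + (cmod (v j))\<^sup>2) / 2))"
  proof (intro sum_norm_le)
    fix i j assume ij: "i \<in> {..<q}" "j \<in> {..<q}"
    have "cmod (Y i j) \<le> r / real q" using assms[of i j] ij by (simp add: field_simps)
    moreover have "cmod (v i) * cmod (v j) \<le> ((cmod (v i))\<^sup>2 + (cmod (v j))\<^sup>2) / 2"
      using sum_squares_bound[of "cmod (v i)" "cmod (v j)"] by simp
    ultimately have "cmod (Y i j) * (cmod (v i) * cmod (v j))
        \<le> r / real q * (((cmod (v i))\<^sup>2 + (cmod (v j))\<^sup>2) / 2)"
      by (intro mult_mono) (auto intro: order_trans[OF norm_ge_zero])
    then show "cmod (cnj (v i) * Y i j * v j) \<le> r / real q * (((cmod (v i))\<^sup>2 + (cmod (v j))\<^sup>2) / 2)"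
      by (simp add: norm_mult mult_ac)
  qed
  also have "\<dots> = r / real q * (real q * ?n)"
    unfolding sum_distrib_left[symmetric] sum_divide_distrib[symmetric] sum.distrib
    by (simp add: field_simps flip: sum_distrib_left)
  also have "\<dots> = r * ?n" by simp
  finally have "- (r * ?n) \<le> Re (\<Sum>i<q. \<Sum>j<q. cnj (v i) * Y i j * v j)"
    using abs_Re_le_cmod[of "\<Sum>i<q. \<Sum>j<q. cnj (v i) * Y i j * v j"] by linarith
  then show "0 \<le> Re (\<Sum>i<q. \<Sum>j<q. cnj (v i) * ?W i j * v j)" using split by linarith
qed

text \<open>The factor 2 in the smallness bound leaves room beyond positive semi-definiteness:
  diagonal entries are strictly positive, so the trace c can be divided out.\<close>

lemma near_scalar_is_multiple_of_DM:
  assumes q: "0 < q" and r: "0 < r"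
    and Y: "Y \<in> sq_mats q" "\<And>i j. Y j i = cnj (Y i j)"
    and small: "\<And>i j. i < q \<Longrightarrow> j < q \<Longrightarrow> 2 * real q * cmod (Y i j) \<le> r"
  shows "\<exists>c B. 0 < c \<and> B \<in> DM q \<and>
    (\<forall>i j. (if i < q \<and> i = j then of_real r else 0) + Y i j = of_real c * B i j)"
proof -
  define W where "W = (\<lambda>i j. (if i < q \<and> i = j then complex_of_real r else 0) + Y i j)"
  define c where "c = Re (mat_trace q W)"
  have herm: "W j i = cnj (W i j)" for i j using Y(2)[of i j] by (auto simp: W_def)
  have psd: "psd_mat q W" unfolding W_def
  proof (rule psd_mat_diagonally_perturbed)
    fix i j assume "i < q" "j < q"
    moreover have "0 \<le> real q * cmod (Y i j)" by simp
    ultimately show "real q * cmod (Y i j) \<le> r" using small[of i j] by linarith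
  qed
  have diag: "W i i = of_real (Re (W i i))" for i using herm[of i i] by (simp add: complex_eq_iff)
  then have tr: "mat_trace q W = of_real c"
    unfolding c_def mat_trace_def Re_sum of_real_sum by (intro sum.cong) auto
  have "0 < Re (W i i)" if i: "i < q" for i
  proof -
    have "2 * cmod (Y i i) \<le> 2 * real q * cmod (Y i i)" using q by (simp add: mult_right_mono)
    then have "cmod (Y i i) < r" using small[OF i i] r by linarith
    then show ?thesis using abs_Re_le_cmod[of "Y i i"] i by (simp add: W_def)
  qed
  then have c: "0 < c" using q unfolding c_def mat_trace_def Re_sum by (intro sum_pos) auto
  define B where "B = (\<lambda>i j. W i j / of_real c)"
  have "psd_mat q B"
    unfolding psd_mat_def
  proof
    fix v :: "nat \<Rightarrow> complex"
    have "(\<Sum>i<q. \<Sum>j<q. cnj (v i) * B i j * v j)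
        = (\<Sum>i<q. \<Sum>j<q. cnj (v i) * W i j * v j) / of_real c"
      by (simp add: B_def sum_divide_distrib)
    then show "0 \<le> Re (\<Sum>i<q. \<Sum>j<q. cnj (v i) * B i j * v j)"
      using psd c by (simp add: psd_mat_def)
  qed
  moreover have "mat_trace q B = 1"
    using tr c by (simp add: B_def mat_trace_def flip: sum_divide_distrib)
  moreover have "hermitian_mat q B"
    unfolding hermitian_mat_def B_def complex_cnj_divide complex_cnj_complex_of_real
    using herm by metis
  moreover have "B \<in> sq_mats q" using Y(1) by (auto simp: sq_mats_def B_def W_def)
  ultimately have "B \<in> DM q" by (simp add: DM_def)
  moreover have "W i j = of_real c * B i j" for i j using c by (simp add: B_def)
  ultimately show ?thesis using c unfolding W_def by blast
qed

lemma Sigma_k_mono: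
  assumes "0 < m" "m \<le> k" shows "Sigma_k ns m \<subseteq> Sigma_k ns k"
proof
  fix X assume "X \<in> Sigma_k ns m"
  then obtain c B where cB: "\<And>i. i < m \<Longrightarrow> 0 \<le> c i" "\<And>i. i < m \<Longrightarrow> B i \<in> product_DM ns"
    "(\<Sum>i<m. c i) = 1" "X = (\<lambda>a b. \<Sum>i<m. complex_of_real (c i) * B i a b)"
    by (auto simp: Sigma_k_def)
  \<comment> \<open>Padding terms have weight 0 but must still be product states; \<open>B 0\<close>
    is available because m is positive.\<close>
  define c' B' where "c' = (\<lambda>i. if i < m then c i else 0)" and "B' = (\<lambda>i. if i < m then B i else B 0)"
  have "(\<Sum>i<k. c' i) = (\<Sum>i<m. c' i)"
    using assms by (intro sum.mono_neutral_right) (auto simp: c'_def)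
  moreover have "(\<Sum>i<k. of_real (c' i) * B' i a b) = (\<Sum>i<m. complex_of_real (c' i) * B' i a b)" for a b
    using assms by (intro sum.mono_neutral_right) (auto simp: c'_def)
  ultimately show "X \<in> Sigma_k ns k"
    using cB assms unfolding Sigma_k_def mem_Collect_eq
    by (intro exI[of _ c'] exI[of _ B']) (auto simp: c'_def B'_def)
qed

lemma Sigma_k_interior:
  assumes pos: "\<forall>n\<in>set ms. 0 < n" "0 < q" and k: "prod_list (map (\<lambda>n. n^2) ms) \<le> k"
  obtains X\<^sub>0 \<epsilon> where "X\<^sub>0 \<in> tau_mats (prod_list (ms @ [q]))" "0 < \<epsilon>"
    "\<And>X. X \<in> tau_mats (prod_list (ms @ [q])) \<Longrightarrow> (\<And>i j. cmod (X i j - X\<^sub>0 i j) \<le> \<epsilon>)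
      \<Longrightarrow> X \<in> Sigma_k (ms @ [q]) k"
proof -
  let ?M = "prod_list ms" and ?N = "prod_list (ms @ [q])"
  define m where "m = prod_list (map (\<lambda>n. n^2) ms)"
  have m: "0 < m" using pos(1) unfolding m_def by (induction ms) auto
  have N: "?N = ?M * q" by simp
  obtain D \<gamma> where "\<forall>s<m. D s \<in> product_DM ms" "\<forall>s a b. \<gamma> s b a = cnj (\<gamma> s a b)"
    "\<forall>a<?M. \<forall>b<?M. \<forall>i j. (\<Sum>s<m. \<gamma> s a b * D s i j) = unit_mat a b i j"
    using hermitian_spanning_product_DM[OF pos(1), folded m_def] by (elim exE conjE) (rule that)
  then have D: "s < m \<Longrightarrow> D s \<in> product_DM ms"
    and \<gamma>: "\<gamma> s b a = cnj (\<gamma> s a b)"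
    and unit: "a < ?M \<Longrightarrow> b < ?M \<Longrightarrow> (\<Sum>s<m. \<gamma> s a b * D s i j) = unit_mat a b i j" for s a b i j
    by blast+
  \<comment> \<open>Chosen so that each of the m summands \<open>kron q (D s) R\<close> has trace
    1/m.\<close>
  define r where "r = 1 / (real m * real q)"
  have r: "0 < r" using m pos(2) by (simp add: r_def)
  define R :: cmat where "R = (\<lambda>i j. if i < q \<and> i = j then of_real r else 0)"
  define X\<^sub>0 where "X\<^sub>0 = (\<lambda>i j. \<Sum>s<m. kron q (D s) R i j)"
  have D_tau: "D s \<in> tau_mats ?M" if "s < m" for s using D[OF that] product_DM_subset by blast
  have R: "mat_trace q R = of_real (1 / real m)" "R j i = cnj (R i j)" for i j
    using pos(2) by (auto simp: mat_trace_def R_def r_def)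
  have X0: "X\<^sub>0 \<in> tau_mats ?N"
  proof (rule tau_matsI)
    have "kron q (D s) R \<in> sq_mats ?N" if "s < m" for s
      unfolding N using D_tau[OF that] pos(2) by (intro kron_sq_mats) (auto simp: tau_mats_def)
    then show "X\<^sub>0 \<in> sq_mats ?N"
      unfolding X\<^sub>0_def sq_mats_def mem_Collect_eq by (metis (mono_tags, lifting) lessThan_iff sum.neutral)
    show "X\<^sub>0 j i = cnj (X\<^sub>0 i j)" for i j
      unfolding X\<^sub>0_def kron_def cnj_sum complex_cnj_mult
      by (intro sum.cong refl) (metis R(2) D_tau tau_mats_entry_cnj lessThan_iff)
    have "mat_trace ?N X\<^sub>0 = (\<Sum>s<m. mat_trace (?M * q) (kron q (D s) R))"
      unfolding X\<^sub>0_def mat_trace_def N by (rule sum.swap)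
    also have "\<dots> = (\<Sum>s<m. of_real (1 / real m))"
      using D_tau unfolding mat_trace_kron R(1) by (intro sum.cong) (auto simp: tau_mats_def)
    also have "\<dots> = 1" using m by simp
    finally show "mat_trace ?N X\<^sub>0 = 1" .
  qed
  \<comment> \<open>Contraction with any \<open>\<gamma> s\<close> enlarges entries by at most this
    factor, so the choice of \<open>\<epsilon>\<close> below keeps the entries of Y within r / (2q).
    The leading 1 makes it safe to divide by.\<close>
  define \<Gamma> where "\<Gamma> = 1 + (\<Sum>s<m. \<Sum>a<?M. \<Sum>b<?M. cmod (\<gamma> s a b))"
  have \<Gamma>: "0 < \<Gamma>" unfolding \<Gamma>_def by (intro add_pos_nonneg sum_nonneg) auto
  define \<epsilon> where "\<epsilon> = r / (2 * real q * \<Gamma>)"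
  have \<epsilon>: "0 < \<epsilon>" using r pos(2) \<Gamma> by (simp add: \<epsilon>_def)
  have "X \<in> Sigma_k (ms @ [q]) m"
    if X: "X \<in> tau_mats ?N" and close: "\<And>i j. cmod (X i j - X\<^sub>0 i j) \<le> \<epsilon>" for X
  proof -
    define Z where "Z = (\<lambda>i j. X i j - X\<^sub>0 i j)"
    have Z_sq: "Z i j = 0" if "\<not> (i < ?N \<and> j < ?N)" for i j
    proof -
      have "X \<in> sq_mats ?N" "X\<^sub>0 \<in> sq_mats ?N" using X X0 unfolding tau_mats_def by blast+
      from sq_matsD[OF this(1) that] sq_matsD[OF this(2) that] show ?thesis by (simp add: Z_def)
    qed
    have Z_cnj: "cnj (Z i j) = Z j i" for i j
      unfolding Z_def complex_cnj_diff
      using tau_mats_entry_cnj[OF X, of j i] tau_mats_entry_cnj[OF X0, of j i] by simp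
    \<comment> \<open>Z is an array of q x q blocks Z_ab and equals the sum of the E_ab \<otimes>
      Z_ab. Expanding each unit E_ab in the \<open>D s\<close> and collecting terms leaves this
      combination of blocks beside \<open>D s\<close>.\<close>
    define Y where "Y = (\<lambda>s i j. if i < q \<and> j < q
        then \<Sum>a<?M. \<Sum>b<?M. \<gamma> s a b * Z (a * q + i) (b * q + j) else 0)"
    have Y_sq: "Y s \<in> sq_mats q" for s by (auto simp: Y_def sq_mats_def)
    have Y_cnj: "Y s j i = cnj (Y s i j)" for s i j
    proof (cases "i < q \<and> j < q")
      case True
      have "cnj (Y s i j) = (\<Sum>a<?M. \<Sum>b<?M. \<gamma> s b a * Z (b * q + j) (a * q + i))"
        using True by (simp add: Y_def Z_cnj \<gamma>[symmetric])
      also have "\<dots> = Y s j i" using True by (subst sum.swap) (simp add: Y_def)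
      finally show ?thesis by simp
    qed (auto simp: Y_def)
    have Y_small: "2 * real q * cmod (Y s i j) \<le> r" if "s < m" "i < q" "j < q" for s i j
    proof -
      have "cmod (Y s i j) \<le> (\<Sum>a<?M. \<Sum>b<?M. cmod (\<gamma> s a b) * \<epsilon>)"
        using that close by (auto simp: Y_def Z_def norm_mult intro!: sum_norm_le mult_left_mono)
      also have "\<dots> = (\<Sum>a<?M. \<Sum>b<?M. cmod (\<gamma> s a b)) * \<epsilon>"
        by (simp only: sum_distrib_right)
      also have "\<dots> \<le> \<Gamma> * \<epsilon>"
      proof (intro mult_right_mono)
        have "(\<Sum>a<?M. \<Sum>b<?M. cmod (\<gamma> s a b)) \<le> (\<Sum>s<m. \<Sum>a<?M. \<Sum>b<?M. cmod (\<gamma> s a b))"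
          using that(1) by (intro member_le_sum[of s "{..<m}"] sum_nonneg) auto
        then show "(\<Sum>a<?M. \<Sum>b<?M. cmod (\<gamma> s a b)) \<le> \<Gamma>" by (simp add: \<Gamma>_def)
      qed (use \<epsilon> in simp)
      also have "\<dots> = r / (2 * real q)" using \<Gamma> by (simp add: \<epsilon>_def)
      finally show ?thesis using pos(2) by (simp add: field_simps)
    qed
    have "\<exists>c B. 0 < c \<and> B \<in> DM q \<and> (\<forall>i j. R i j + Y s i j = of_real c * B i j)" if "s < m" for s
      unfolding R_def by (rule near_scalar_is_multiple_of_DM[OF pos(2) r Y_sq Y_cnj Y_small[OF that]])
    then obtain c B where c: "\<And>s. s < m \<Longrightarrow> 0 < c s" and B: "\<And>s. s < m \<Longrightarrow> B s \<in> DM q"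
      and cB: "\<And>s i j. s < m \<Longrightarrow> R i j + Y s i j = of_real (c s) * B s i j" by metis
    have Z_eq: "Z i j = (\<Sum>s<m. D s (i div q) (j div q) * Y s (i mod q) (j mod q))" for i j
    proof -
      let ?i = "i div q" and ?j = "j div q" and ?z = "\<lambda>a b. Z (a * q + i mod q) (b * q + j mod q)"
      have "(\<Sum>s<m. D s ?i ?j * Y s (i mod q) (j mod q))
          = (\<Sum>s<m. \<Sum>a<?M. \<Sum>b<?M. \<gamma> s a b * D s ?i ?j * ?z a b)"
        using pos(2) by (simp add: Y_def sum_distrib_left mult_ac)
      also have "\<dots> = (\<Sum>a<?M. \<Sum>s<m. \<Sum>b<?M. \<gamma> s a b * D s ?i ?j * ?z a b)"
        by (rule sum.swap)
      also have "\<dots> = (\<Sum>a<?M. \<Sum>b<?M. \<Sum>s<m. \<gamma> s a b * D s ?i ?j * ?z a b)"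
        by (intro sum.cong refl sum.swap)
      also have "\<dots> = (\<Sum>a<?M. \<Sum>b<?M. unit_mat a b ?i ?j * ?z a b)"
        unfolding sum_distrib_right[symmetric] by (intro sum.cong refl) (simp add: unit)
      also have "\<dots> = (\<Sum>a<?M. if a = ?i then (\<Sum>b<?M. if b = ?j then ?z a b else 0) else 0)"
        by (intro sum.cong refl) (auto simp: unit_mat_def intro!: sum.cong)
      also have "\<dots> = (if ?i < ?M \<and> ?j < ?M then Z i j else 0)"
        by simp
      also have "\<dots> = Z i j"
        using Z_sq[of i j] pos(2) unfolding N by (auto simp: div_less_iff_less_mult)
      finally show ?thesis by simp
    qed
    have X_eq: "X i j = (\<Sum>s<m. of_real (c s) * kron q (D s) (B s) i j)" for i j
    proof -
      have "X i j = X\<^sub>0 i j + Z i j" by (simp add: Z_def)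
      also have "\<dots> = (\<Sum>s<m. D s (i div q) (j div q) * (R (i mod q) (j mod q) + Y s (i mod q) (j mod q)))"
        unfolding Z_eq X\<^sub>0_def kron_def sum.distrib[symmetric] by (simp add: distrib_left)
      also have "\<dots> = (\<Sum>s<m. of_real (c s) * kron q (D s) (B s) i j)"
        by (intro sum.cong refl) (simp add: cB kron_def)
      finally show ?thesis .
    qed
    \<comment> \<open>The scalars \<open>c s\<close> were found independently of each other; that
      they sum to 1 is read off from the trace of X, as all \<open>D s\<close> and
      \<open>B s\<close> have trace 1.\<close>
    have "1 = mat_trace ?N X" using X by (simp add: tau_mats_def)
    also have "\<dots> = (\<Sum>i<?M * q. \<Sum>s<m. of_real (c s) * kron q (D s) (B s) i i)"
      by (simp only: mat_trace_def X_eq N)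
    also have "\<dots> = (\<Sum>s<m. of_real (c s) * mat_trace (?M * q) (kron q (D s) (B s)))"
      unfolding mat_trace_def sum_distrib_left by (rule sum.swap)
    also have "\<dots> = (\<Sum>s<m. of_real (c s))"
      unfolding mat_trace_kron using D_tau B by (intro sum.cong) (auto simp: tau_mats_def DM_def)
    finally have "(\<Sum>s<m. c s) = 1" by (metis of_real_1 of_real_eq_iff of_real_sum)
    then show ?thesis
      unfolding Sigma_k_def mem_Collect_eq
      using c B D X_eq
      by (intro exI[of _ c] exI[of _ "\<lambda>s. kron q (D s) (B s)"])
        (auto simp: less_imp_le intro!: kron_product_DM_snoc ext)
  qed
  then show thesis using that X0 \<epsilon> Sigma_k_mono[OF m k[folded m_def]] by blast
qed

lemma openin_tau_space_cube:
  "openin (top_of_set (tau_space N)) {x \<in> tau_space N. \<forall>t<N^2-1. \<bar>x t - x\<^sub>0 t\<bar> < \<delta>}"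
proof -
  have "open (\<Inter>t\<in>{..<N^2-1}. {x :: nat \<Rightarrow> real. \<bar>x t - x\<^sub>0 t\<bar> < \<delta>})"
    by (intro open_INT ballI open_Collect_less continuous_intros continuous_on_product_coordinates) auto
  moreover have "{x \<in> tau_space N. \<forall>t<N^2-1. \<bar>x t - x\<^sub>0 t\<bar> < \<delta>}
      = tau_space N \<inter> (\<Inter>t\<in>{..<N^2-1}. {x. \<bar>x t - x\<^sub>0 t\<bar> < \<delta>})" by auto
  ultimately show ?thesis unfolding openin_open by blast
qed

lemma tau_coords_Sigma_k_interior:
  assumes pos: "\<forall>n\<in>set ms. 0 < n" "0 < q" and k: "prod_list (map (\<lambda>n. n^2) ms) \<le> k"
  defines "N \<equiv> prod_list (ms @ [q])"
  obtains x\<^sub>0 \<delta> where "x\<^sub>0 \<in> tau_space N" "0 < \<delta>"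
    "{x \<in> tau_space N. \<forall>t<N^2-1. \<bar>x t - x\<^sub>0 t\<bar> < \<delta>} \<subseteq> tau_coords N ` Sigma_k (ms @ [q]) k"
proof -
  obtain X\<^sub>0 \<epsilon> where X0: "X\<^sub>0 \<in> tau_mats N" and \<epsilon>: "0 < \<epsilon>"
    and near: "\<And>X. X \<in> tau_mats N \<Longrightarrow> (\<And>i j. cmod (X i j - X\<^sub>0 i j) \<le> \<epsilon>) \<Longrightarrow> X \<in> Sigma_k (ms @ [q]) k"
    using Sigma_k_interior[OF assms(1-3), folded N_def] by blast
  have N: "0 < N" using pos unfolding N_def by (induction ms) auto
  \<comment> \<open>Compensates the distortion N + 2 of decoding, so a coordinate cube lands in the
    entrywise \<epsilon>-neighbourhood.\<close>
  define \<delta> where "\<delta> = \<epsilon> / (real N + 2)"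
  have \<delta>: "0 < \<delta>" "(real N + 2) * \<delta> = \<epsilon>" using \<epsilon> by (auto simp: \<delta>_def)
  have "x \<in> tau_coords N ` Sigma_k (ms @ [q]) k"
    if x: "x \<in> tau_space N" "\<forall>t<N^2-1. \<bar>x t - tau_coords N X\<^sub>0 t\<bar> < \<delta>" for x
  proof
    show eq: "x = tau_coords N (tau_decode N x)" using tau_coords_decode[OF N x(1)] by simp
    show "tau_decode N x \<in> Sigma_k (ms @ [q]) k"
    proof (rule near)
      show "tau_decode N x \<in> tau_mats N" by (rule tau_decode_mem[OF N])
      fix i j
      have "cmod (tau_decode N x i j - X\<^sub>0 i j) \<le> (real N + 2) * \<delta>"
        by (rule tau_mats_diff[OF N tau_decode_mem[OF N] X0])
          (use x(2) \<delta>(1) eq in \<open>auto simp: less_imp_le\<close>)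
      then show "cmod (tau_decode N x i j - X\<^sub>0 i j) \<le> \<epsilon>" by (simp add: \<delta>(2))
    qed
  qed
  then show thesis using that[OF tau_coords_mem \<delta>(1)] by blast
qed

text \<open>The real denominator is 1 + \<Sum> (n_j^2 - 1). Positivity of the sizes makes the
  natural-number subtraction exact, and the denominator is at least 1, so it can be multiplied
  out.\<close>

lemma dimension_bound_nat:
  assumes pos: "\<forall>n\<in>set ns. 0 < n"
    and k: "real k < (\<Prod>n\<leftarrow>ns. real n ^ 2) / (1 - real (length ns) + (\<Sum>n\<leftarrow>ns. real n ^ 2))"
  shows "k * (1 + (\<Sum>j<length ns. (ns ! j)^2 - 1)) < (prod_list ns)^2"
proof -
  have "(\<Sum>n\<leftarrow>ns. real n ^ 2) - real (length ns) = (\<Sum>j<length ns. real (ns ! j) ^ 2 - 1)"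
    by (simp add: sum_list_sum_nth sum_subtractf atLeast0LessThan)
  also have "\<dots> = (\<Sum>j<length ns. real ((ns ! j)^2 - 1))"
  proof (intro sum.cong refl)
    fix j assume "j \<in> {..<length ns}"
    then have "0 < ns ! j" using pos by simp
    then have "1 \<le> (ns ! j)^2" by (simp add: Suc_le_eq)
    then show "real (ns ! j) ^ 2 - 1 = real ((ns ! j)^2 - 1)" by (simp add: of_nat_diff)
  qed
  finally have denom: "1 - real (length ns) + (\<Sum>n\<leftarrow>ns. real n ^ 2)
      = real (1 + (\<Sum>j<length ns. (ns ! j)^2 - 1))" by simp
  have num: "(\<Prod>n\<leftarrow>ns. real n ^ 2) = real ((prod_list ns)^2)"
    by (induction ns) (auto simp: power_mult_distrib)
  have "0 < real (1 + (\<Sum>j<length ns. (ns ! j)^2 - 1))" by (simp only: of_nat_0_less_iff)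
  then have "real k * real (1 + (\<Sum>j<length ns. (ns ! j)^2 - 1)) < real ((prod_list ns)^2)"
    using k unfolding denom num by (simp only: pos_less_divide_eq)
  then show ?thesis by (simp only: of_nat_mult[symmetric] of_nat_less_iff)
qed

theorem theorem2:
  fixes ns :: "nat list" and k :: nat
  assumes p_pos: "ns \<noteq> []"
    and n_pos: "\<forall>n \<in> set ns. 0 < n"
    and k_pos: "0 < k"
  defines "N \<equiv> prod_list ns"
  defines "C \<equiv> tau_coords N"
  shows
    "(compact (C ` Sigma_k ns k) \<and> connected (C ` Sigma_k ns k)
      \<and> Sigma_k ns k \<subseteq> Sigma_sep ns
      \<and> (Sigma_k ns k \<noteq> Sigma_sep ns \<longrightarrow>
           \<not> (C ` Sigma_sep ns \<subseteq> closure (C ` Sigma_k ns k))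
         \<and> openin (top_of_set (C ` Sigma_sep ns)) (C ` (Sigma_sep ns - Sigma_k ns k))))
     \<and> (real k < (\<Prod>n\<leftarrow>ns. real n ^ 2) / (1 - real (length ns) + (\<Sum>n\<leftarrow>ns. real n ^ 2))
          \<longrightarrow> C ` Sigma_k ns k \<in> null_sets (tau_lebesgue N))
     \<and> (sorted ns \<and> k \<ge> prod_list (map (\<lambda>n. n ^ 2) (butlast ns))
          \<longrightarrow> emeasure (tau_lebesgue N) (C ` Sigma_k ns k) > 0
            \<and> (\<exists>U. U \<noteq> {} \<and> openin (top_of_set (tau_space N)) U
                   \<and> U \<subseteq> C ` Sigma_k ns k))"
proof -
  have N: "0 < N" using n_pos unfolding N_def by (induction ns) auto
  have compact: "compact (C ` Sigma_k ns k)"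
    unfolding C_def by (rule compact_tau_coords_Sigma_k[OF p_pos])
  have connected: "connected (C ` Sigma_k ns k)"
    unfolding C_def by (rule connected_tau_coords_Sigma_k[OF p_pos])
  from compact have closed: "closed (C ` Sigma_k ns k)" by (rule compact_imp_closed)
  \<comment> \<open>Injectivity of the coordinates is what transfers set differences and proper
    inclusions of matrices to their images.\<close>
  have inj: "inj_on C (Sigma_sep ns)"
    unfolding C_def using inj_on_subset[OF inj_on_tau_coords[OF N]] Sigma_sep_subset N_def by blast
  have sub: "Sigma_k ns k \<subseteq> Sigma_sep ns" by (rule Sigma_k_subset_Sigma_sep)
  have diff: "C ` (Sigma_sep ns - Sigma_k ns k) = C ` Sigma_sep ns - C ` Sigma_k ns k"
    by (rule inj_on_image_set_diff[OF inj Diff_subset sub])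
  \<comment> \<open>The image is closed, so density would mean inclusion of the images and, by
    injectivity, equality of the two sets.\<close>
  have not_dense: "\<not> (C ` Sigma_sep ns \<subseteq> closure (C ` Sigma_k ns k))"
    if "Sigma_k ns k \<noteq> Sigma_sep ns"
    using that sub inj closed by (auto simp: closure_closed inj_on_image_subset_iff)
  have "openin (top_of_set (C ` Sigma_sep ns)) (C ` (Sigma_sep ns - Sigma_k ns k))"
    unfolding diff openin_open using closed by (intro exI[of _ "- (C ` Sigma_k ns k)"]) auto
  moreover have "C ` Sigma_k ns k \<in> null_sets (tau_lebesgue N)"
    if "real k < (\<Prod>n\<leftarrow>ns. real n ^ 2) / (1 - real (length ns) + (\<Sum>n\<leftarrow>ns. real n ^ 2))"
    unfolding C_def N_def
    by (rule null_sets_tau_coords_Sigma_k[OF p_pos n_pos k_pos dimension_bound_nat[OF n_pos that]])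
  moreover have "emeasure (tau_lebesgue N) (C ` Sigma_k ns k) > 0
      \<and> (\<exists>U. U \<noteq> {} \<and> openin (top_of_set (tau_space N)) U \<and> U \<subseteq> C ` Sigma_k ns k)"
    if k: "prod_list (map (\<lambda>n. n ^ 2) (butlast ns)) \<le> k"
  proof -
    have split: "ns = butlast ns @ [last ns]" using p_pos by simp
    have "\<forall>n\<in>set (butlast ns). 0 < n" "0 < last ns" using n_pos p_pos by (auto dest: in_set_butlastD)
    from tau_coords_Sigma_k_interior[OF this k] obtain x\<^sub>0 \<delta> where x0: "x\<^sub>0 \<in> tau_space N" "0 < \<delta>"
      and U: "{x \<in> tau_space N. \<forall>t<N^2-1. \<bar>x t - x\<^sub>0 t\<bar> < \<delta>} \<subseteq> C ` Sigma_k ns k"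
      unfolding split[symmetric] C_def N_def by blast
    \<comment> \<open>A closed box of half the radius fits into the open cube and has an explicit
      positive volume.\<close>
    let ?box = "PiE {..<N^2-1} (\<lambda>t. {x\<^sub>0 t - \<delta> / 2..x\<^sub>0 t + \<delta> / 2})"
    have "?box \<subseteq> {x \<in> tau_space N. \<forall>t<N^2-1. \<bar>x t - x\<^sub>0 t\<bar> < \<delta>}"
    proof
      fix x assume x: "x \<in> ?box"
      have "\<bar>x t - x\<^sub>0 t\<bar> < \<delta>" if "t < N^2-1" for t
      proof -
        have "x t \<in> {x\<^sub>0 t - \<delta> / 2..x\<^sub>0 t + \<delta> / 2}" using x that by (intro PiE_mem[OF x]) simp
        then show ?thesis using x0(2) by (simp add: abs_less_iff)
      qed
      then show "x \<in> {x \<in> tau_space N. \<forall>t<N^2-1. \<bar>x t - x\<^sub>0 t\<bar> < \<delta>}"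
        using x by (simp add: tau_space_def PiE_iff)
    qed
    moreover have "C ` Sigma_k ns k \<in> sets (tau_lebesgue N)"
      unfolding tau_lebesgue_def
      by (rule closed_imp_sets_PiM_lborel[OF closed])
        (use tau_coords_mem[of N] in \<open>unfold C_def tau_space_def, blast\<close>)
    ultimately have "emeasure (tau_lebesgue N) ?box \<le> emeasure (tau_lebesgue N) (C ` Sigma_k ns k)"
      using U by (intro emeasure_mono) auto
    moreover have "emeasure (tau_lebesgue N) ?box > 0"
      using x0(2) unfolding tau_lebesgue_def by (subst emeasure_PiM_lborel_cube) auto
    ultimately have "emeasure (tau_lebesgue N) (C ` Sigma_k ns k) > 0" by (rule less_le_trans[rotated])
    moreover have "x\<^sub>0 \<in> {x \<in> tau_space N. \<forall>t<N^2-1. \<bar>x t - x\<^sub>0 t\<bar> < \<delta>}" using x0 by simp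
    ultimately show ?thesis
      using U openin_tau_space_cube by (intro conjI exI[of _ "{x \<in> tau_space N. \<forall>t<N^2-1. \<bar>x t - x\<^sub>0 t\<bar> < \<delta>}"]) auto
  qed
  ultimately show ?thesis
    using compact connected sub not_dense by (intro conjI impI) simp_all
qed

end
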